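(* Let $T$ be a real, non-singular matrix transformation of the torus $\mathbb{T}^d$. Suppose that $T$ is diagonal with all eigenvalues $\beta_1,\beta_2,\dots,\beta_d$ strictly larger than $1$. Assume that $1<\beta_1\le\beta_2\le\cdots\le\beta_d$. Let $\psi:\mathbb{R}^+\to\mathbb{R}^+$ be a real positive function with lower order at infinity $\lambda=\lambda(\psi)\ge0$ and let $\mathbf{a}\in\mathbb{T}^d$. Then $$\dim_{\rm H}W(T,\psi,\mathbf{a})=\min_{1\le i\le d}\theta_i(\lambda),$$ where $$\theta_i(\lambda):=\frac{i\log\beta_i-\sum\limits_{k:\,\beta_k>\beta_ie^\lambda}(\log\beta_k-\log\beta_i-\lambda)+\sum\limits_{k>i}\log\beta_k}{\lambda+\log\beta_i}.$$
   Context: Matrix transformation: a real $d\times d$ matrix $T$ determines a self-map of $\mathbb{T}^d=\mathbb{R}^d/\mathbb{Z}^d$ (identified with $[0,1)^d$), also denoted $T$, sending $\mathbf{x}\in[0,1)^d$ to $T\mathbf{x}$ modulo one. $T^n$ denotes the $n$-th iterate of this map (not the matrix power). $\|\cdot\|$ is the distance to the nearest integer. For $\mathbf{a}=(a_1,\dots,a_d)$ let $B(\mathbf{a},\psi(n)):=\{\mathbf{x}\in\mathbb{T}^d:\max_{1\le i\le d}\|x_i-a_i\|\le\psi(n)\}$ and $$W(T,\psi,\mathbf{a}):=\{\mathbf{x}\in\mathbb{T}^d:T^n(\mathbf{x})\in B(\mathbf{a},\psi(n))\text{ for infinitely many }n\in\mathbb{N}\}.$$ Lower order at infinity: $\lambda=\lambda(\psi):=\liminf_{n\to\infty}\frac{-\log\psi(n)}{n}$.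 If $\lambda=+\infty$, $\theta_i(\lambda)$ is read as its limit as $\lambda\to\infty$, namely $0$. $\dim_{\rm H}$ is Hausdorff dimension. *)

theory Defs
  imports "HOL-Analysis.Analysis"
begin

subsection \<open>Hausdorff dimension in a metric space\<close>

definition (in Metric_space) mdiameter :: "'a set \<Rightarrow> real" where
  "mdiameter U = (if U = {} then 0 else SUP (x, y) \<in> U \<times> U. d x y)"

text \<open>
  The case distinction is needed because \<open>0 powr 0 = 0\<close>: a nonempty set contributes 1 when the
  exponent is 0, also if it is a singleton.
\<close>
definition (in Metric_space) hausdorff_gauge :: "real \<Rightarrow> 'a set \<Rightarrow> ennreal" where
  "hausdorff_gauge s U =
     (if U = {} then 0 else if s = 0 then 1 else ennreal (mdiameter U powr s))"

text \<open>
  The real-valued supremum in \<open>mdiameter\<close> is meaningful for the sets of a cover below: their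
  distances are bounded by \<open>\<delta>\<close>. Finite covers are included, since members may be empty.
\<close>
definition (in Metric_space) delta_covers :: "real \<Rightarrow> 'a set \<Rightarrow> (nat \<Rightarrow> 'a set) set" where
  "delta_covers \<delta> A =
     {U. A \<subseteq> (\<Union>n. U n) \<and> (\<forall>n. U n \<subseteq> M) \<and> (\<forall>n. \<forall>x\<in>U n. \<forall>y\<in>U n. d x y \<le> \<delta>)}"

definition (in Metric_space) hausdorff_premeasure :: "real \<Rightarrow> real \<Rightarrow> 'a set \<Rightarrow> ennreal" where
  "hausdorff_premeasure s \<delta> A = (INF U \<in> delta_covers \<delta> A. \<Sum>n. hausdorff_gauge s (U n))"

definition (in Metric_space) hausdorff_measure :: "real \<Rightarrow> 'a set \<Rightarrow> ennreal" where
  "hausdorff_measure s A = (SUP \<delta> \<in> {0<..}. hausdorff_premeasure s \<delta> A)"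

definition (in Metric_space) hausdorff_dim :: "'a set \<Rightarrow> ereal" where
  "hausdorff_dim A = (INF s \<in> {s. 0 \<le> s \<and> hausdorff_measure s A = 0}. ereal s)"

subsection \<open>The torus\<close>

definition nint_dist :: "real \<Rightarrow> real" where
  "nint_dist x = \<bar>x - of_int (round x)\<bar>"

text \<open>The torus is represented by its fundamental domain, with the metric of the quotient.\<close>

definition torus :: "(real ^ 'n) set" where
  "torus = {x. \<forall>i. 0 \<le> x $ i \<and> x $ i < 1}"

definition torus_dist :: "real ^ 'n \<Rightarrow> real ^ 'n \<Rightarrow> real" where
  "torus_dist x y = (MAX i. nint_dist (x $ i - y $ i))"

lemma nint_dist_le: "nint_dist x \<le> \<bar>x - of_int m\<bar>"
  unfolding nint_dist_def by (rule round_diff_minimal)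

lemma nint_dist_nonneg: "0 \<le> nint_dist x"
  by (simp add: nint_dist_def)

lemma nint_dist_minus: "nint_dist (- x) = nint_dist x"
proof -
  have "nint_dist (- y) \<le> nint_dist y" for y
    using nint_dist_le[of "- y" "- round y"] by (simp add: nint_dist_def)
  from this[of x] this[of "- x"] show ?thesis by simp
qed

lemma nint_dist_triangle: "nint_dist (x + y) \<le> nint_dist x + nint_dist y"
  using nint_dist_le[of "x + y" "round x + round y"] by (simp add: nint_dist_def)

lemma nint_dist_eq_0_iff:
  assumes "0 \<le> x" "x < 1" "0 \<le> y" "y < 1"
  shows "nint_dist (x - y) = 0 \<longleftrightarrow> x = y"
proof
  assume "nint_dist (x - y) = 0"
  then have eq: "x - y = of_int (round (x - y))"
    by (simp add: nint_dist_def)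
  then have "of_int (round (x - y)) < (1 :: real)" "(-1 :: real) < of_int (round (x - y))"
    using assms by linarith+
  then have "round (x - y) = 0" by linarith
  with eq show "x = y" by simp
qed (simp add: nint_dist_def)

lemma nint_dist_le_torus_dist: "nint_dist (x $ i - y $ i) \<le> torus_dist x y"
  unfolding torus_dist_def by (rule Max_ge) auto

lemma torus_dist_le_iff: "torus_dist x y \<le> r \<longleftrightarrow> (\<forall>i. nint_dist (x $ i - y $ i) \<le> r)"
  unfolding torus_dist_def by (subst Max_le_iff) auto

lemma Metric_space_torus: "Metric_space (torus :: (real ^ 'n) set) torus_dist"
proof
  fix x y z :: "real ^ 'n"
  show nonneg: "0 \<le> torus_dist x y" for x y :: "real ^ 'n"
    using nint_dist_nonneg nint_dist_le_torus_dist order_trans by blast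
  show "torus_dist x y = torus_dist y x"
    unfolding torus_dist_def by (metis minus_diff_eq nint_dist_minus)
  show "torus_dist x y = 0 \<longleftrightarrow> x = y" if "x \<in> torus" "y \<in> torus"
  proof -
    have "torus_dist x y = 0 \<longleftrightarrow> torus_dist x y \<le> 0"
      using nonneg[of x y] by linarith
    also have "\<dots> \<longleftrightarrow> (\<forall>i. nint_dist (x $ i - y $ i) = 0)"
      by (simp add: torus_dist_le_iff nint_dist_nonneg order_antisym_conv)
    also have "\<dots> \<longleftrightarrow> x = y"
      using that by (auto simp: torus_def nint_dist_eq_0_iff vec_eq_iff)
    finally show ?thesis .
  qed
  show "torus_dist x z \<le> torus_dist x y + torus_dist y z"
    unfolding torus_dist_le_iff
  proof
    fix i
    have "nint_dist (x $ i - z $ i) \<le> nint_dist (x $ i - y $ i) + nint_dist (y $ i - z $ i)"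
      using nint_dist_triangle[of "x $ i - y $ i" "y $ i - z $ i"] by simp
    also have "\<dots> \<le> torus_dist x y + torus_dist y z"
      by (intro add_mono nint_dist_le_torus_dist)
    finally show "nint_dist (x $ i - z $ i) \<le> torus_dist x y + torus_dist y z" .
  qed
qed

abbreviation torus_hausdorff_dim :: "(real ^ 'n) set \<Rightarrow> ereal" where
  "torus_hausdorff_dim \<equiv> Metric_space.hausdorff_dim torus torus_dist"

subsection \<open>Shrinking targets for matrix transformations\<close>

definition torus_map :: "real ^ 'n ^ 'n \<Rightarrow> real ^ 'n \<Rightarrow> real ^ 'n" where
  "torus_map T x = (\<chi> i. frac ((T *v x) $ i))"

definition torus_ball :: "real ^ 'n \<Rightarrow> real \<Rightarrow> (real ^ 'n) set" where
  "torus_ball a r = {x \<in> torus. (MAX i. nint_dist (x $ i - a $ i)) \<le> r}"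

definition shrinking_target_set ::
    "real ^ 'n ^ 'n \<Rightarrow> (real \<Rightarrow> real) \<Rightarrow> real ^ 'n \<Rightarrow> (real ^ 'n) set" where
  "shrinking_target_set T \<psi> a =
     {x \<in> torus. infinite {n :: nat. n \<ge> 1 \<and> (torus_map T ^^ n) x \<in> torus_ball a (\<psi> (real n))}}"

definition lower_order :: "(real \<Rightarrow> real) \<Rightarrow> ereal" where
  "lower_order \<psi> = liminf (\<lambda>n :: nat. ereal (- ln (\<psi> (real n)) / real n))"

definition diagonal_matrix :: "real ^ 'n ^ 'n \<Rightarrow> bool" where
  "diagonal_matrix T \<longleftrightarrow> (\<forall>i j. i \<noteq> j \<longrightarrow> T $ i $ j = 0)"

text \<open>
  \<open>\<beta> 1, \<dots>, \<beta> d\<close> are all the eigenvalues of \<open>T\<close>, counted with algebraic multiplicity: they are the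
  roots of the characteristic polynomial of \<open>T\<close>. The numbering of the eigenvalues need not agree
  with any order of the coordinates.
\<close>
definition eigenvalues_of :: "real ^ 'n ^ 'n \<Rightarrow> (nat \<Rightarrow> real) \<Rightarrow> bool" where
  "eigenvalues_of T \<beta> \<longleftrightarrow> (\<forall>x. det (mat x - T) = (\<Prod>i = 1..CARD('n). x - \<beta> i))"

text \<open>The value at \<open>\<infinity>\<close> is the limit as \<open>l\<close> tends to infinity.\<close>

definition theta :: "nat \<Rightarrow> (nat \<Rightarrow> real) \<Rightarrow> nat \<Rightarrow> ereal \<Rightarrow> real" where
  "theta d \<beta> i \<Lambda> =
     (if \<Lambda> = \<infinity> then 0
      else let l = real_of_ereal \<Lambda> in
        (real i * ln (\<beta> i)
          - (\<Sum>k | k \<in> {1..d} \<and> \<beta> k > \<beta> i * exp l. ln (\<beta> k) - ln (\<beta> i) - l)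
          + (\<Sum>k \<in> {i<..d}. ln (\<beta> k)))
        / (l + ln (\<beta> i)))"

end

theory Submission
  imports Defs "HOL-Probability.Probability"
begin

text \<open>
  For \<open>\<rho> > 0\<close>, about \<open>exp (n f k \<rho>)\<close> intervals of length \<open>exp (- n \<rho>)\<close>, where
  \<open>f k \<rho> = max (min \<rho> (ln (\<beta> k))) (\<rho> - \<lambda>)\<close>, are needed to cover the points whose \<open>n\<close>-th
  image under \<open>x \<mapsto> \<beta> k x mod 1\<close> is within \<open>exp (- n \<lambda>)\<close> of a given point. The dimension turns out
  to be the infimum over \<open>\<rho>\<close> of \<open>(\<Sum>k. f k \<rho>) / \<rho>\<close>. Each \<open>f k\<close> is concave except for a kink at
  \<open>\<rho> = ln (\<beta> k) + \<lambda>\<close>, so the infimum is attained at one of the kinks, and the value at the \<open>i\<close>-th kink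
  is \<open>\<theta> i \<lambda>\<close>.

  The upper bound is the natural cover at scale \<open>exp (- n \<rho>)\<close>. For the lower bound, choose a very
  sparse sequence of times \<open>n\<close> with \<open>\<psi> n > exp (- n (\<lambda> + \<eta>))\<close> and, in each coordinate, points
  whose orbit is free between these times and steered into the target at them. Independent uniform
  choices of the free parts give a random point that lies in a ball of radius \<open>r\<close> with probability
  at most \<open>C r powr s\<close>. Since \<open>\<beta> k\<close> need not be an integer, only full cylinders, those which an iterate
  maps onto \<open>[0, 1)\<close>, can be concatenated freely; they make up a positive proportion of the
  unit interval.
\<close>

section \<open>Full cylinders of the beta transformation\<close>

text \<open>One scale \<open>\<rho>\<close> serves all coordinates because covering sets and
  measured sets are cubes, so the exponents of the coordinates add up. The upper bound may pick the
  best \<open>\<rho>\<close>; the lower bound must face every \<open>\<rho>\<close>, since an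
  arbitrary radius \<open>r\<close> is written as \<open>exp (- \<rho> * n)\<close> for a steering
  time \<open>n\<close>. Hence the same infimum on both sides. The coordinates expand at different
  rates, so one \<open>r\<close> is compared with cylinders at time \<open>n\<close> in some
  coordinates and at the next steering time in others; independence of the coordinates permits this.
  Full cylinders are counted through a decomposition: each cylinder of order \<open>n\<close> is a
  full one of some order \<open>k\<close> followed by the rightmost one of order
  \<open>n - k\<close>, so a shortage of full ones would leave too few cylinders to cover the unit
  interval. The lower order is a liminf: radii are bounded above at all late times, but below only
  along a subsequence, each time with a loss in the exponent that can be made arbitrarily
  small.\<close>

lemma card_separated_le:
  fixes S :: "real set"
  assumes h: "0 < h" and uv: "u \<le> v" and S: "S \<subseteq> {u..v}"
    and sep: "\<And>x y. x \<in> S \<Longrightarrow> y \<in> S \<Longrightarrow> x < y \<Longrightarrow> x + h \<le> y"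
  shows "finite S" "real (card S) \<le> (v - u) / h + 1"
proof -
  define g where "g x = \<lfloor>(x - u) / h\<rfloor>" for x
  have inj: "inj_on g S"
  proof (rule linorder_inj_onI)
    fix x y assume xy: "x < y" "x \<in> S" "y \<in> S"
    then have "((x - u) + h) / h \<le> (y - u) / h"
      using sep[of x y] h by (intro divide_right_mono) auto
    then have "(x - u) / h + 1 \<le> (y - u) / h"
      using h by (simp add: add_divide_distrib)
    then show "g x \<noteq> g y" unfolding g_def by linarith
  qed auto
  have sub: "g ` S \<subseteq> {0..\<lfloor>(v - u) / h\<rfloor>}"
  proof (safe)
    fix x assume "x \<in> S"
    then have "u \<le> x" "x \<le> v" using S by auto
    then show "g x \<in> {0..\<lfloor>(v - u) / h\<rfloor>}"
      using h unfolding g_def by (auto intro!: floor_mono divide_right_mono)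
  qed
  have fin: "finite (g ` S)" using sub finite_subset by blast
  then show "finite S" using inj finite_imageD by blast
  have "card S = card (g ` S)" using inj card_image by metis
  also have "\<dots> \<le> card {0..\<lfloor>(v - u) / h\<rfloor>}" using sub card_mono by blast
  finally have "card S \<le> nat (\<lfloor>(v - u) / h\<rfloor> + 1)" by simp
  moreover have "0 \<le> \<lfloor>(v - u) / h\<rfloor>" using h uv by simp
  ultimately have "real (card S) \<le> \<lfloor>(v - u) / h\<rfloor> + 1" by linarith
  then show "real (card S) \<le> (v - u) / h + 1" by linarith
qed

lemma length_le_of_cover:
  fixes Z :: "real set"
  assumes "finite Z" "0 < h" "0 \<le> r" and cov: "{x..<x + r} \<subseteq> (\<Union>z\<in>Z. {z..<z + h})"
  shows "r \<le> real (card Z) * h"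
proof -
  have "measure lborel {x..<x + r} \<le> measure lborel (\<Union>z\<in>Z. {z..<z + h})"
    using assms by (intro measure_mono_fmeasurable fmeasurable.finite_UN) (auto simp: fmeasurable_def)
  also have "\<dots> \<le> (\<Sum>z\<in>Z. measure lborel {z..<z + h})"
    using assms by (intro measure_UNION_le) auto
  finally show ?thesis using assms by (simp)
qed

definition beta_map :: "real \<Rightarrow> real \<Rightarrow> real" where
  "beta_map b x = frac (b * x)"

text \<open>A full cylinder is encoded by its left endpoint \<open>c\<close>: the map sending
  \<open>y\<close> to \<open>c + y / b ^ n\<close> is an inverse branch of the \<open>n\<close>-th
  iterate on all of \<open>[0, 1)\<close>.\<close>

definition full_branches :: "real \<Rightarrow> nat \<Rightarrow> real set" where
  "full_branches b n = {c. \<forall>y. 0 \<le> y \<and> y < 1 \<longrightarrow>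
     0 \<le> c + y / b ^ n \<and> c + y / b ^ n < 1 \<and> (beta_map b ^^ n) (c + y / b ^ n) = y}"

lemma full_branchesD:
  assumes "c \<in> full_branches b n" "0 \<le> y" "y < 1"
  shows "0 \<le> c + y / b ^ n" "c + y / b ^ n < 1" "(beta_map b ^^ n) (c + y / b ^ n) = y"
  using assms by (auto simp: full_branches_def)

lemma beta_map_bounds: "0 \<le> beta_map b x" "beta_map b x < 1"
  by (auto simp: beta_map_def frac_lt_1)

lemma funpow_beta_map_bounds:
  assumes "0 \<le> x" "x < 1"
  shows "0 \<le> (beta_map b ^^ n) x" "(beta_map b ^^ n) x < 1"
  using assms by (induction n) (auto simp: beta_map_bounds)

text \<open>Inverse branches that are defined on the whole of \<open>[0, 1)\<close> compose. This is
  the free concatenation on which the towers rest.\<close>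

lemma full_branches_comp:
  assumes c: "c \<in> full_branches b m" and c': "c' \<in> full_branches b n"
  shows "c + c' / b ^ m \<in> full_branches b (m + n)"
  unfolding full_branches_def
proof (safe)
  fix y :: real assume y: "0 \<le> y" "y < 1"
  define z where "z = c' + y / b ^ n"
  have z: "0 \<le> z" "z < 1" "(beta_map b ^^ n) z = y"
    using full_branchesD[OF c' y] by (auto simp: z_def)
  have eq: "c + c' / b ^ m + y / b ^ (m + n) = c + z / b ^ m"
    by (simp add: z_def power_add field_simps add_divide_distrib)
  note * = full_branchesD[OF c z(1,2)]
  show "0 \<le> c + c' / b ^ m + y / b ^ (m + n)" "c + c' / b ^ m + y / b ^ (m + n) < 1"
    using * eq by auto
  have "(beta_map b ^^ (n + m)) (c + z / b ^ m) = y"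
    using * z by (simp add: funpow_add)
  then show "(beta_map b ^^ (m + n)) (c + c' / b ^ m + y / b ^ (m + n)) = y"
    unfolding eq by (simp add: add.commute)
qed

text \<open>
  The cylinders of order \<open>n\<close> are governed by the orbit of 1: after \<open>j\<close> steps the rightmost
  cylinder \<open>[1 - t / b ^ j, 1)\<close> of order \<open>j\<close> is mapped onto \<open>[0, t)\<close>, where
  \<open>t = branch_end b j\<close>. The ceiling (instead of the floor) keeps \<open>t\<close> in \<open>(0, 1]\<close>.
\<close>
fun branch_end :: "real \<Rightarrow> nat \<Rightarrow> real" where
  "branch_end b 0 = 1"
| "branch_end b (Suc j) = b * branch_end b j - of_int (\<lceil>b * branch_end b j\<rceil> - 1)"

context
  fixes b :: real
  assumes b: "1 < b"
begin

lemma base_pos [simp]: "0 < b" "0 \<le> b" and base_power_pos [simp]: "0 < b ^ n" "0 \<le> b ^ n"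
  using b by simp_all

lemma full_branches_zero: "0 \<in> full_branches b n"
proof (induction n)
  case 0 then show ?case by (simp add: full_branches_def)
next
  case (Suc n)
  have "0 \<in> full_branches b 1"
    using b by (auto simp: full_branches_def beta_map_def frac_eq divide_less_eq)
  then show ?case using full_branches_comp[OF Suc, of 0 1] by simp
qed

text \<open>Appending leftmost branches lengthens a full cylinder's address without moving its left
  endpoint.\<close>

lemma full_branches_mono: "n \<le> n' \<Longrightarrow> full_branches b n \<subseteq> full_branches b n'"
  using full_branches_comp[OF _ full_branches_zero, of _ n "n' - n"] by auto

lemma full_branches_ge: "c \<in> full_branches b n \<Longrightarrow> 0 \<le> c"
  using full_branchesD(1)[of c b n 0] by simp

lemma full_branches_le:
  assumes "c \<in> full_branches b n"
  shows "c + 1 / b ^ n \<le> 1"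
proof (rule ccontr)
  assume "\<not> ?thesis"
  then have *: "1 - c < 1 / b ^ n" by simp
  have c1: "c < 1" using full_branchesD(2)[OF assms, of 0] by simp
  have "(1 - c) * b ^ n < 1" using * by (simp add: pos_less_divide_eq)
  \<comment> \<open>If the cylinder reached beyond 1, the parameter \<open>(1 - c) * b ^ n\<close>
    would be admissible, and its point is 1 itself.\<close>
  then have "c + ((1 - c) * b ^ n) / b ^ n < 1"
    using c1 by (intro full_branchesD(2)[OF assms]) auto
  then show False using b by simp
qed

text \<open>If the cylinders overlapped, \<open>c'\<close> would lie in the cylinder of
  \<open>c\<close> and have two \<open>n\<close>-th images: 0 by its own branch and the nonzero
  \<open>(c' - c) * b ^ n\<close> by the other.\<close>

lemma full_branches_separated:
  assumes "c \<in> full_branches b n" "c' \<in> full_branches b n" "c < c'"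
  shows "c + 1 / b ^ n \<le> c'"
proof (rule ccontr)
  assume "\<not> ?thesis"
  then have "c' - c < 1 / b ^ n" by simp
  then have *: "(c' - c) * b ^ n < 1" by (simp add: pos_less_divide_eq)
  have "(beta_map b ^^ n) (c + (c' - c) * b ^ n / b ^ n) = (c' - c) * b ^ n"
    using * assms by (intro full_branchesD(3)) auto
  moreover have "(beta_map b ^^ n) (c' + 0 / b ^ n) = 0"
    using assms by (intro full_branchesD(3)) auto
  ultimately have "(c' - c) * b ^ n = 0" using b by simp
  then show False using assms b by simp
qed

lemma finite_full_branches: "finite (full_branches b n)"
  and card_full_branches_le: "real (card (full_branches b n)) \<le> b ^ n"
proof -
  have sub: "full_branches b n \<subseteq> {0..1 - 1 / b ^ n}"
    using full_branches_ge full_branches_le by (fastforce simp: algebra_simps)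
  have "1 / b ^ n \<le> 1" using b by simp
  then have *: "0 \<le> 1 - 1 / b ^ n" by linarith
  note card = card_separated_le[OF _ * sub, of "1 / b ^ n"]
  show "finite (full_branches b n)"
    using card full_branches_separated by auto
  show "real (card (full_branches b n)) \<le> b ^ n"
    using card(2) full_branches_separated b by (auto simp: algebra_simps diff_divide_distrib)
qed

lemma card_full_branches_pos: "0 < card (full_branches b n)"
  using finite_full_branches full_branches_zero card_gt_0_iff by blast

lemma full_branches_comp_inj:
  assumes "c1 \<in> full_branches b m" "c2 \<in> full_branches b m" "0 \<le> x1" "x1 < 1" "0 \<le> x2" "x2 < 1"
    and "c1 + x1 / b ^ m = c2 + x2 / b ^ m"
  shows "c1 = c2 \<and> x1 = x2"
proof -
  have "x1 = x2" using full_branchesD(3) assms by metis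
  then show ?thesis using assms by simp
qed

lemma branch_end_bounds: "0 < branch_end b j" "branch_end b j \<le> 1"
  by (induction j) (simp_all, linarith+)

lemma rightmost_branch:
  assumes "0 \<le> y" "y < branch_end b j"
  shows "0 \<le> 1 - branch_end b j / b ^ j + y / b ^ j"
    and "1 - branch_end b j / b ^ j + y / b ^ j < 1"
    and "(beta_map b ^^ j) (1 - branch_end b j / b ^ j + y / b ^ j) = y"
proof -
  have "branch_end b j / b ^ j \<le> 1"
    using order_trans[OF branch_end_bounds(2) one_le_power[of b j]] b by (simp add: divide_le_eq)
  moreover have "0 \<le> y / b ^ j" using assms by simp
  ultimately show "0 \<le> 1 - branch_end b j / b ^ j + y / b ^ j" by linarith
  have "y / b ^ j < branch_end b j / b ^ j" using assms by (intro divide_strict_right_mono) auto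
  then show "1 - branch_end b j / b ^ j + y / b ^ j < 1" by linarith
  show "(beta_map b ^^ j) (1 - branch_end b j / b ^ j + y / b ^ j) = y"
    using assms
  proof (induction j arbitrary: y)
    case 0 then show ?case by simp
  next
    case (Suc j)
    define t where "t = branch_end b j"
    \<comment> \<open>The largest integer strictly below \<open>b * t\<close>, hence the last digit
      available on \<open>[0, t)\<close>. Thus \<open>(d + y) / b < t\<close> holds precisely for
      \<open>y < b * t - d\<close>.\<close>
    define d where "d = \<lceil>b * t\<rceil> - 1"
    have t': "branch_end b (Suc j) = b * t - d" by (simp add: t_def d_def)
    have d: "0 \<le> d" using branch_end_bounds[of j] b unfolding d_def t_def by (simp add: less_imp_le)
    have le: "branch_end b (Suc j) \<le> 1" by (rule branch_end_bounds)
    have y1: "y < 1" using Suc.prems le by linarith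
    have "(d + y) / b < t" using Suc.prems b t' by (simp add: divide_less_eq mult.commute)
    then have IH: "(beta_map b ^^ j) (1 - t / b ^ j + ((d + y) / b) / b ^ j) = (d + y) / b"
      unfolding t_def using Suc.prems d b by (intro Suc.IH) auto
    have eq: "1 - branch_end b (Suc j) / b ^ Suc j + y / b ^ Suc j = 1 - t / b ^ j + ((d + y) / b) / b ^ j"
      unfolding t' using b by (simp add: field_simps)
    have "frac (of_int d + y) = y" using y1 Suc.prems by (simp add: frac_unique_iff)
    then show ?case unfolding eq funpow.simps o_apply IH using b by (simp add: beta_map_def)
  qed
qed

text \<open>
  Every point lies in the rightmost cylinder of order \<open>n - k\<close> inside some full cylinder of
  order \<open>k\<close>.
\<close>
lemma cylinder_decomposition:
  assumes "0 \<le> x" "x < 1"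
  shows "\<exists>k\<le>n. \<exists>c\<in>full_branches b k. (beta_map b ^^ n) x < branch_end b (n - k) \<and>
           x = c + (1 - branch_end b (n - k) / b ^ (n - k) + (beta_map b ^^ n) x / b ^ (n - k)) / b ^ k"
proof (induction n)
  case 0
  then show ?case using full_branches_zero[of 0] assms by (auto intro!: bexI[of _ 0])
next
  case (Suc n)
  define y where "y = (beta_map b ^^ n) x"
  have y: "0 \<le> y" "y < 1" using funpow_beta_map_bounds assms by (auto simp: y_def)
  from Suc obtain k c where k: "k \<le> n" and c: "c \<in> full_branches b k" and
    yt: "y < branch_end b (n - k)" and
    x: "x = c + (1 - branch_end b (n - k) / b ^ (n - k) + y / b ^ (n - k)) / b ^ k"
    unfolding y_def by auto
  define j where "j = n - k"
  define t where "t = branch_end b j"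
  define e where "e = \<lfloor>b * y\<rfloor>"
  have e0: "0 \<le> e" using y b by (simp add: e_def)
  have Sy: "(beta_map b ^^ Suc n) x = b * y - e"
    by (simp add: y_def[symmetric] beta_map_def frac_def e_def)
  have ylt: "y < t" using yt by (simp add: t_def j_def)
  have bk: "b ^ n = b ^ j * b ^ k" using k by (simp add: j_def power_add[symmetric])
  have "b * y < b * t" using ylt b by simp
  then have "e \<le> \<lceil>b * t\<rceil> - 1" unfolding e_def by linarith
  \<comment> \<open>With the last available digit the point stays in the rightmost part, now one
    step longer. With a smaller digit all of \<open>[e / b, (e + 1) / b)\<close> lies in
    \<open>[0, t)\<close>, so a full cylinder of order \<open>Suc n\<close> is completed and
    \<open>k\<close> is reset to \<open>Suc n\<close>.\<close>
  then consider "e = \<lceil>b * t\<rceil> - 1" | "e < \<lceil>b * t\<rceil> - 1" by linarith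
  then show ?case
  proof cases
    case 1
    have t': "branch_end b (Suc n - k) = b * t - e"
      using k 1 by (simp add: Suc_diff_le t_def j_def)
    have "x = c + (1 - (b * t - e) / b ^ Suc j + (b * y - e) / b ^ Suc j) / b ^ k"
      unfolding x j_def[symmetric] t_def[symmetric] using b by (simp add: field_simps)
    moreover have "b * y - e < b * t - e" using \<open>b * y < b * t\<close> by simp
    moreover have "Suc n - k = Suc j" using k by (simp add: j_def)
    ultimately show ?thesis using k c t' Sy
      by (intro exI[of _ k] conjI bexI[of _ c]) auto
  next
    case 2
    define c' where "c' = c + (1 - t / b ^ j + (e / b) / b ^ j) / b ^ k"
    have et: "real_of_int e + 1 < b * t" using 2 by linarith
    have "c' \<in> full_branches b (Suc n)"
      unfolding full_branches_def
    proof (safe)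
      fix z :: real assume z: "0 \<le> z" "z < 1"
      define w where "w = (e + z) / b"
      have w: "0 \<le> w" "w < t" using z et e0 b by (auto simp: w_def divide_less_eq mult.commute)
      note * = rightmost_branch[of w j, folded t_def, OF w]
      note ** = full_branchesD[OF c *(1,2)]
      have eq: "c' + z / b ^ Suc n = c + (1 - t / b ^ j + w / b ^ j) / b ^ k"
        unfolding c'_def w_def power_Suc bk using b by (simp add: field_simps)
      show "0 \<le> c' + z / b ^ Suc n" "c' + z / b ^ Suc n < 1" unfolding eq using ** by auto
      have "(beta_map b ^^ (j + k)) (c' + z / b ^ Suc n) = w"
        unfolding eq funpow_add using * ** by simp
      moreover have "frac (of_int e + z) = z" using z by (simp add: frac_unique_iff)
      ultimately show "(beta_map b ^^ Suc n) (c' + z / b ^ Suc n) = z"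
        using k b by (simp add: j_def beta_map_def w_def)
    qed
    moreover have "x = c' + (b * y - e) / b ^ Suc n"
      unfolding c'_def power_Suc bk x j_def[symmetric] t_def[symmetric]
      using b by (simp add: field_simps)
    moreover have "b * y - e < 1" unfolding e_def by linarith
    ultimately show ?thesis using Sy by (intro exI[of _ "Suc n"] conjI bexI[of _ c']) auto
  qed
qed

text \<open>The left endpoints of all cylinders of order \<open>n\<close>, full or not, listed
  according to the decomposition above.\<close>

definition cylinder_starts :: "nat \<Rightarrow> real set" where
  "cylinder_starts n = (\<Union>k\<le>n. (\<lambda>c. c + (1 - branch_end b (n - k) / b ^ (n - k)) / b ^ k) ` full_branches b k)"

lemma finite_cylinder_starts: "finite (cylinder_starts n)"
  unfolding cylinder_starts_def using finite_full_branches by auto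

lemma card_cylinder_starts_le_sum:
  "card (cylinder_starts n) \<le> (\<Sum>k\<le>n. card (full_branches b k))"
proof -
  have "card (cylinder_starts n) \<le> (\<Sum>k\<le>n. card ((\<lambda>c. c + (1 - branch_end b (n - k) / b ^ (n - k)) / b ^ k) ` full_branches b k))"
    unfolding cylinder_starts_def by (rule card_UN_le) auto
  also have "\<dots> \<le> (\<Sum>k\<le>n. card (full_branches b k))"
    by (intro sum_mono card_image_le finite_full_branches)
  finally show ?thesis .
qed

lemma sum_power_le: "(\<Sum>k\<le>n. b ^ k) \<le> b / (b - 1) * b ^ n"
proof -
  have "(\<Sum>k\<le>n. b ^ k) = (b ^ Suc n - 1) / (b - 1)"
    using b geometric_sum[of b "Suc n"] by (simp add: lessThan_Suc_atMost)
  also have "\<dots> \<le> b ^ Suc n / (b - 1)" using b by (intro divide_right_mono) auto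
  finally show ?thesis by simp
qed

lemma card_cylinder_starts_le: "real (card (cylinder_starts n)) \<le> b / (b - 1) * b ^ n"
proof -
  have "real (card (cylinder_starts n)) \<le> real (\<Sum>k\<le>n. card (full_branches b k))"
    using card_cylinder_starts_le_sum of_nat_le_iff by blast
  also have "\<dots> \<le> (\<Sum>k\<le>n. b ^ k)" unfolding of_nat_sum by (intro sum_mono card_full_branches_le)
  finally show ?thesis using sum_power_le order_trans by blast
qed

text \<open>On its cylinder the \<open>n\<close>-th iterate is affine with slope
  \<open>b ^ n\<close> and vanishes at the left endpoint, which is therefore the displayed
  point.\<close>

lemma cylinder_start_mem:
  assumes "0 \<le> x" "x < 1"
  shows "x - (beta_map b ^^ n) x / b ^ n \<in> cylinder_starts n"
proof -
  obtain k c where kc: "k \<le> n" "c \<in> full_branches b k"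
    "x = c + (1 - branch_end b (n - k) / b ^ (n - k) + (beta_map b ^^ n) x / b ^ (n - k)) / b ^ k"
    using cylinder_decomposition[OF assms, of n] by blast
  have "b ^ n = b ^ (n - k) * b ^ k" using kc by (simp add: power_add[symmetric])
  then have "x - (beta_map b ^^ n) x / b ^ n = c + (1 - branch_end b (n - k) / b ^ (n - k)) / b ^ k"
    using kc(3) by (simp add: add_divide_distrib diff_divide_distrib)
  then show ?thesis unfolding cylinder_starts_def using kc by auto
qed

text \<open>Cylinders of order \<open>n\<close> cover \<open>[0, 1)\<close> and have length at most
  \<open>1 / b ^ n\<close>, so there are at least \<open>b ^ n\<close> of them, while the
  decomposition bounds their number by the sum of the full ones of orders \<open>k \<le> n\<close>.
  Orders below \<open>n - K\<close> contribute at most half of \<open>b ^ n\<close>; each of the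
  remaining at most \<open>Suc K\<close> terms is at most the last one, by monotonicity.\<close>

lemma card_full_branches_ge:
  obtains c where "0 < c" "\<And>n. c * b ^ n \<le> real (card (full_branches b n))"
proof -
  \<comment> \<open>Makes the geometric sum of \<open>b ^ k\<close> over
    \<open>k \<le> n - Suc K\<close> at most \<open>b ^ n / 2\<close>.\<close>
  obtain K where K: "2 / (b - 1) < b ^ K" using b real_arch_pow by blast
  define c where "c = 1 / (2 * real (Suc K))"
  have main: "c * b ^ n \<le> real (card (full_branches b n))" for n
  proof -
    define F where "F k = real (card (full_branches b k))" for k
    have F0: "0 \<le> F k" for k by (simp add: F_def)
    have Fmono: "k \<le> n \<Longrightarrow> F k \<le> F n" for k
      unfolding F_def using full_branches_mono finite_full_branches card_mono of_nat_le_iff by metis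
    have "{0..<0 + 1} \<subseteq> (\<Union>z\<in>cylinder_starts n. {z..<z + 1 / b ^ n})"
    proof
      fix x :: real assume "x \<in> {0..<0 + 1}"
      then have x: "0 \<le> x" "x < 1" by auto
      have "0 \<le> (beta_map b ^^ n) x / b ^ n" "(beta_map b ^^ n) x / b ^ n < 1 / b ^ n"
        using funpow_beta_map_bounds[OF x, of n b] by (auto intro!: divide_strict_right_mono)
      then show "x \<in> (\<Union>z\<in>cylinder_starts n. {z..<z + 1 / b ^ n})"
        using cylinder_start_mem[OF x, of n] by (intro UN_I) auto
    qed
    then have "1 \<le> real (card (cylinder_starts n)) * (1 / b ^ n)"
      by (intro length_le_of_cover[OF finite_cylinder_starts, where x = 0]) auto
    then have "b ^ n \<le> real (card (cylinder_starts n))" using b by (simp add: field_simps)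
    also have "\<dots> \<le> (\<Sum>k\<le>n. F k)"
      unfolding F_def of_nat_sum[symmetric] of_nat_le_iff by (rule card_cylinder_starts_le_sum)
    finally have tot: "b ^ n \<le> (\<Sum>k\<le>n. F k)" .
    also have "(\<Sum>k\<le>n. F k) = (\<Sum>k\<in>{..n} \<inter> {k. n < k + Suc K}. F k) + (\<Sum>k\<in>{..n} \<inter> - {k. n < k + Suc K}. F k)"
      by (subst sum.Int_Diff[of _ _ "{k. n < k + Suc K}"]) (auto simp: Diff_eq)
    also have "(\<Sum>k\<in>{..n} \<inter> {k. n < k + Suc K}. F k) \<le> real (card ({..n} \<inter> {k. n < k + Suc K})) * F n"
      using Fmono by (intro sum_bounded_above) auto
    also have "real (card ({..n} \<inter> {k. n < k + Suc K})) \<le> Suc K"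
    proof -
      have "{..n} \<inter> {k. n < k + Suc K} \<subseteq> (\<lambda>i. n - i) ` {..K}"
      proof
        fix k assume "k \<in> {..n} \<inter> {k. n < k + Suc K}"
        then have "k = n - (n - k)" "n - k \<le> K" by auto
        then show "k \<in> (\<lambda>i. n - i) ` {..K}" by blast
      qed
      then have "card ({..n} \<inter> {k. n < k + Suc K}) \<le> card {..K}" using surj_card_le finite_atMost by blast
      then show ?thesis by simp
    qed
    also have "(\<Sum>k\<in>{..n} \<inter> - {k. n < k + Suc K}. F k) \<le> b ^ n / 2"
    proof (cases "Suc K \<le> n")
      case True
      have "{..n} \<inter> - {k. n < k + Suc K} = {..n - Suc K}" using True by auto
      then have "(\<Sum>k\<in>{..n} \<inter> - {k. n < k + Suc K}. F k) \<le> (\<Sum>k\<le>n - Suc K. b ^ k)"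
        using card_full_branches_le by (auto simp: F_def intro!: sum_mono)
      also have "\<dots> \<le> b / (b - 1) * b ^ (n - Suc K)" by (rule sum_power_le)
      also have "\<dots> = (2 / (b - 1)) * (b ^ Suc (n - Suc K)) / 2" using b by (simp add: field_simps)
      also have "\<dots> \<le> b ^ K * (b ^ Suc (n - Suc K)) / 2"
        using K b by (intro divide_right_mono mult_right_mono) auto
      also have "b ^ K * (b ^ Suc (n - Suc K)) = b ^ n" using True unfolding power_add[symmetric] by simp
      finally show ?thesis .
    next
      case False
      then have "{..n} \<inter> - {k. n < k + Suc K} = {}" by auto
      then show ?thesis using b by simp
    qed
    finally have "b ^ n \<le> Suc K * F n + b ^ n / 2" using F0[of n] by (simp add: mult_right_mono)
    then show ?thesis unfolding c_def F_def by (simp add: field_simps)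
  qed
  have "0 < c" by (simp add: c_def)
  then show thesis using main that by blast
qed

text \<open>Suppose that no full cylinder of order \<open>n\<close> fits. Then every point of the
  interval lies in a full cylinder of some order \<open>k \<le> n\<close> that straddles one of the
  two endpoints. There are at most two of these for each \<open>k\<close>, and each is followed by a
  single rightmost cylinder, so \<open>2 * Suc n\<close> intervals of length
  \<open>1 / b ^ n\<close> cover the interval, which is too long for that.\<close>

lemma full_branch_in_interval:
  assumes x: "0 \<le> x" "x + r \<le> 1" and r: "0 \<le> r" and large: "2 * real (Suc n) < r * b ^ n"
  obtains c where "c \<in> full_branches b n" "x \<le> c" "c + 1 / b ^ n \<le> x + r"
proof (rule ccontr)
  assume neg: "\<not> thesis"
  define B where "B k = {c \<in> full_branches b k. c < x \<and> x < c + 1 / b ^ k} \<union>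
     {c \<in> full_branches b k. c < x + r \<and> x + r < c + 1 / b ^ k}" for k
  have one: "finite {c \<in> full_branches b k. c < u \<and> u < c + 1 / b ^ k} \<and>
     card {c \<in> full_branches b k. c < u \<and> u < c + 1 / b ^ k} \<le> 1" (is "_ \<and> card ?S \<le> 1") for u k
  proof -
    have "c = c'" if "c \<in> ?S" "c' \<in> ?S" for c c'
      using that full_branches_separated[of c k c'] full_branches_separated[of c' k c] by fastforce
    then show ?thesis using finite_full_branches by (auto simp: card_le_Suc0_iff_eq)
  qed
  have B: "finite (B k)" "card (B k) \<le> 2" for k
    unfolding B_def using one[of k x] one[of k "x + r"] card_Un_le[of "{c \<in> full_branches b k. c < x \<and> x < c + 1 / b ^ k}" "{c \<in> full_branches b k. c < x + r \<and> x + r < c + 1 / b ^ k}"] by auto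
  define Z where "Z = (\<Union>k\<le>n. (\<lambda>c. c + (1 - branch_end b (n - k) / b ^ (n - k)) / b ^ k) ` B k)"
  have finZ: "finite Z" unfolding Z_def using B by auto
  have "card Z \<le> (\<Sum>k\<le>n. card ((\<lambda>c. c + (1 - branch_end b (n - k) / b ^ (n - k)) / b ^ k) ` B k))"
    unfolding Z_def by (rule card_UN_le) auto
  also have "\<dots> \<le> (\<Sum>k\<le>n. 2)"
    using B card_image_le order_trans by (intro sum_mono) blast
  finally have cardZ: "real (card Z) \<le> 2 * real (Suc n)" by simp
  have "{x..<x + r} \<subseteq> (\<Union>z\<in>Z. {z..<z + 1 / b ^ n})"
  proof
    fix y assume "y \<in> {x..<x + r}"
    then have y: "x \<le> y" "y < x + r" by auto
    then have y01: "0 \<le> y" "y < 1" using x by auto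
    define w where "w = (beta_map b ^^ n) y"
    have w: "0 \<le> w" "w < 1" using funpow_beta_map_bounds y01 by (auto simp: w_def)
    obtain k c where k: "k \<le> n" and c: "c \<in> full_branches b k" and wt: "w < branch_end b (n - k)" and
      yeq: "y = c + (1 - branch_end b (n - k) / b ^ (n - k) + w / b ^ (n - k)) / b ^ k"
      using cylinder_decomposition[OF y01, of n] unfolding w_def by blast
    define v where "v = 1 - branch_end b (n - k) / b ^ (n - k) + w / b ^ (n - k)"
    have v: "0 \<le> v" "v < 1" unfolding v_def using rightmost_branch w wt by blast+
    have "y = c + v / b ^ k" by (simp add: yeq v_def)
    moreover have "0 \<le> v / b ^ k" "v / b ^ k < 1 / b ^ k" using v by (auto intro: divide_strict_right_mono)
    ultimately have cy: "c \<le> y" "y < c + 1 / b ^ k" by auto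
    have "\<not> (x \<le> c \<and> c + 1 / b ^ k \<le> x + r)"
    proof
      assume H: "x \<le> c \<and> c + 1 / b ^ k \<le> x + r"
      \<comment> \<open>A full cylinder of smaller order inside the interval contains one of order
        \<open>n\<close> with the same left endpoint.\<close>
      have "1 / b ^ n \<le> 1 / b ^ k" using b k by (intro divide_left_mono power_increasing) auto
      then have "c + 1 / b ^ n \<le> x + r" using H by linarith
      then show False using neg that H c full_branches_mono[OF k] by blast
    qed
    then have "c \<in> B k" unfolding B_def using c cy y by auto
    then have z: "c + (1 - branch_end b (n - k) / b ^ (n - k)) / b ^ k \<in> Z" (is "?z \<in> _")
      unfolding Z_def using k by blast
    have "b ^ n = b ^ (n - k) * b ^ k" using k by (simp add: power_add[symmetric])
    then have "y = ?z + w / b ^ n" unfolding yeq by (simp add: add_divide_distrib)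
    moreover have "0 \<le> w / b ^ n" "w / b ^ n < 1 / b ^ n" using w by (auto intro: divide_strict_right_mono)
    ultimately show "y \<in> (\<Union>z\<in>Z. {z..<z + 1 / b ^ n})" using z by (intro UN_I[of ?z]) auto
  qed
  then have "r \<le> real (card Z) * (1 / b ^ n)"
    using finZ r by (intro length_le_of_cover) auto
  then have "r * b ^ n \<le> real (card Z)" by (simp add: field_simps)
  then show False using cardZ large by linarith
qed

end

section \<open>Upper bound\<close>

text \<open>Three regimes: up to \<open>\<rho> = ln b\<close> the trivial cover of the unit interval
  is used; up to \<open>ln b + l\<close> one interval is enough for each of about
  \<open>b ^ n\<close> cylinders; beyond that, each preimage of the target, of length about
  \<open>exp (- n (ln b + l))\<close>, is itself subdivided.\<close>

definition cover_exponent :: "real \<Rightarrow> real \<Rightarrow> real \<Rightarrow> real" where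
  "cover_exponent l b \<rho> = max (min \<rho> (ln b)) (\<rho> - l)"

lemma card_floor_image_le:
  fixes u v r :: real
  assumes "0 < r" "u \<le> v"
  shows "finite ((\<lambda>x. \<lfloor>x / r\<rfloor>) ` {u..v})" "real (card ((\<lambda>x. \<lfloor>x / r\<rfloor>) ` {u..v})) \<le> (v - u) / r + 2"
proof -
  have sub: "(\<lambda>x. \<lfloor>x / r\<rfloor>) ` {u..v} \<subseteq> {\<lfloor>u / r\<rfloor>..\<lfloor>v / r\<rfloor>}"
    using assms by (auto intro!: floor_mono divide_right_mono)
  then show "finite ((\<lambda>x. \<lfloor>x / r\<rfloor>) ` {u..v})" using finite_subset by blast
  have "card ((\<lambda>x. \<lfloor>x / r\<rfloor>) ` {u..v}) \<le> nat (\<lfloor>v / r\<rfloor> + 1 - \<lfloor>u / r\<rfloor>)"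
    using card_mono[OF _ sub] by simp
  moreover have "\<lfloor>u / r\<rfloor> \<le> \<lfloor>v / r\<rfloor>" using assms by (intro floor_mono divide_right_mono) auto
  ultimately have "real (card ((\<lambda>x. \<lfloor>x / r\<rfloor>) ` {u..v})) \<le> \<lfloor>v / r\<rfloor> + 1 - \<lfloor>u / r\<rfloor>" by linarith
  also have "\<dots> \<le> v / r - u / r + 2" by linarith
  finally show "real (card ((\<lambda>x. \<lfloor>x / r\<rfloor>) ` {u..v})) \<le> (v - u) / r + 2" by (simp add: diff_divide_distrib)
qed

lemma nint_dist_leE:
  assumes "\<bar>y\<bar> \<le> 1" "nint_dist y \<le> e"
  obtains m :: int where "m \<in> {-1, 0, 1}" "\<bar>y - of_int m\<bar> \<le> e"
proof -
  have "round y \<in> {-1, 0, 1}" proof -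
    have "-1 \<le> round y" "round y \<le> 1" using assms(1) unfolding round_def by linarith+
    then show ?thesis by auto
  qed
  then show thesis using assms(2) that unfolding nint_dist_def by blast
qed

text \<open>Each point is a cylinder start plus its \<open>n\<close>-th image divided by
  \<open>b ^ n\<close>, and that image is near one of \<open>a - 1\<close>, \<open>a\<close>,
  \<open>a + 1\<close> because the distance wraps around. So three short intervals for each cylinder
  contain the set. For \<open>\<rho> \<le> ln b\<close> all grid cells of the unit interval are
  counted.\<close>

lemma target_grid_count:
  assumes b: "1 < b" and l: "0 \<le> l" and \<rho>: "0 < \<rho>" and a: "0 \<le> a" "a < 1"
  obtains C where "0 < C"
    and "\<And>n. finite ((\<lambda>x. \<lfloor>x / exp (- \<rho> * real n)\<rfloor>) ` {x. 0 \<le> x \<and> x < 1 \<and> nint_dist ((beta_map b ^^ n) x - a) \<le> exp (- l * real n)})"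
    and "\<And>n. real (card ((\<lambda>x. \<lfloor>x / exp (- \<rho> * real n)\<rfloor>) ` {x. 0 \<le> x \<and> x < 1 \<and> nint_dist ((beta_map b ^^ n) x - a) \<le> exp (- l * real n)}))
           \<le> C * exp (cover_exponent l b \<rho> * real n)"
proof -
  define D where "D n = {x. 0 \<le> x \<and> x < 1 \<and> nint_dist ((beta_map b ^^ n) x - a) \<le> exp (- l * real n)}" for n
  define r where "r n = exp (- \<rho> * real n)" for n
  have rpos: "0 < r n" for n by (simp add: r_def)
  show thesis
  proof (cases "\<rho> \<le> ln b")
    case True
    have e: "cover_exponent l b \<rho> = \<rho>" using True l by (simp add: cover_exponent_def)
    have sub: "(\<lambda>x. \<lfloor>x / r n\<rfloor>) ` D n \<subseteq> (\<lambda>x. \<lfloor>x / r n\<rfloor>) ` {0..1}" for n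
      unfolding D_def by (intro image_mono) auto
    have "real (card ((\<lambda>x. \<lfloor>x / r n\<rfloor>) ` D n)) \<le> 3 * exp (\<rho> * real n)" for n
    proof -
      have "real (card ((\<lambda>x. \<lfloor>x / r n\<rfloor>) ` D n)) \<le> (1 - 0) / r n + 2"
        using card_mono[OF card_floor_image_le(1) sub] card_floor_image_le(2)[of "r n" 0 1] rpos[of n] by fastforce
      also have "(1 - 0) / r n = exp (\<rho> * real n)" by (simp add: r_def exp_minus field_simps)
      finally have "real (card ((\<lambda>x. \<lfloor>x / r n\<rfloor>) ` D n)) \<le> exp (\<rho> * real n) + 2" .
      moreover have "1 \<le> exp (\<rho> * real n)" using \<rho> by simp
      ultimately show ?thesis by linarith
    qed
    then show thesis using that[of 3] finite_subset[OF sub card_floor_image_le(1)] rpos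
      unfolding e D_def r_def by simp
  next
    case False
    define C1 where "C1 = b / (b - 1)"
    have C1: "0 < C1" using b by (simp add: C1_def)
    define e where "e n = exp (- l * real n)" for n
    define H where "H n z m = {z + (a + of_int m - e n) / b ^ n..z + (a + of_int m + e n) / b ^ n}" for n z and m :: int
    define J where "J n = (\<Union>p\<in>cylinder_starts b n \<times> {-1, 0, 1}. (\<lambda>x. \<lfloor>x / r n\<rfloor>) ` H n (fst p) (snd p))" for n
    have epos: "0 < e n" for n by (simp add: e_def)
    have Hord: "z + (a + of_int m - e n) / b ^ n \<le> z + (a + of_int m + e n) / b ^ n" for n z and m :: int
      using epos[of n] b by (intro add_left_mono divide_right_mono) auto
    have sub: "(\<lambda>x. \<lfloor>x / r n\<rfloor>) ` D n \<subseteq> J n" for n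
    proof
      fix k assume "k \<in> (\<lambda>x. \<lfloor>x / r n\<rfloor>) ` D n"
      then obtain x where x: "x \<in> D n" "k = \<lfloor>x / r n\<rfloor>" by auto
      define y where "y = (beta_map b ^^ n) x"
      have x01: "0 \<le> x" "x < 1" and ya: "nint_dist (y - a) \<le> e n" using x by (auto simp: D_def y_def e_def)
      have y: "0 \<le> y" "y < 1" using funpow_beta_map_bounds x01 by (auto simp: y_def)
      have "\<bar>y - a\<bar> \<le> 1" using y a by linarith
      then obtain m :: int where m: "m \<in> {-1, 0, 1}" "\<bar>y - a - of_int m\<bar> \<le> e n"
        using ya nint_dist_leE by blast
      define z where "z = x - y / b ^ n"
      have z: "z \<in> cylinder_starts b n" using cylinder_start_mem[OF b x01] by (simp add: z_def y_def)
      have "(a + of_int m - e n) / b ^ n \<le> y / b ^ n" "y / b ^ n \<le> (a + of_int m + e n) / b ^ n"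
        using m b by (auto intro!: divide_right_mono)
      then have "x \<in> H n z m" by (auto simp: H_def z_def)
      then show "k \<in> J n" using z m x unfolding J_def by (intro UN_I[of "(z, m)"]) auto
    qed
    have finH: "finite ((\<lambda>x. \<lfloor>x / r n\<rfloor>) ` H n z m)" for n z m
      unfolding H_def by (rule card_floor_image_le(1)[OF rpos Hord])
    have finJ: "finite (J n)" for n unfolding J_def
      using finH finite_cylinder_starts[OF b] by (intro finite_UN_I) auto
    have "real (card ((\<lambda>x. \<lfloor>x / r n\<rfloor>) ` D n)) \<le> 12 * C1 * exp (cover_exponent l b \<rho> * real n)" for n
    proof -
      have bn: "b ^ n = exp (ln b * real n)" using b by (simp add: exp_of_nat2_mult)
      have cardH: "real (card ((\<lambda>x. \<lfloor>x / r n\<rfloor>) ` H n z m)) \<le> 2 * (e n / b ^ n / r n) + 2" for z m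
      proof -
        have "real (card ((\<lambda>x. \<lfloor>x / r n\<rfloor>) ` H n z m)) \<le>
           (z + (a + of_int m + e n) / b ^ n - (z + (a + of_int m - e n) / b ^ n)) / r n + 2"
          unfolding H_def by (rule card_floor_image_le(2)[OF rpos Hord])
        also have "z + (a + of_int m + e n) / b ^ n - (z + (a + of_int m - e n) / b ^ n) = 2 * (e n / b ^ n)"
          by (simp add: add_divide_distrib diff_divide_distrib)
        finally show ?thesis by simp
      qed
      have "card ((\<lambda>x. \<lfloor>x / r n\<rfloor>) ` D n) \<le> card (J n)" using sub finJ card_mono by blast
      also have "\<dots> \<le> (\<Sum>p\<in>cylinder_starts b n \<times> {-1, 0, 1}. card ((\<lambda>x. \<lfloor>x / r n\<rfloor>) ` H n (fst p) (snd p)))"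
        unfolding J_def using finite_cylinder_starts[OF b] by (intro card_UN_le) auto
      finally have "real (card ((\<lambda>x. \<lfloor>x / r n\<rfloor>) ` D n)) \<le>
         (\<Sum>p\<in>cylinder_starts b n \<times> {-1, 0, 1::int}. real (card ((\<lambda>x. \<lfloor>x / r n\<rfloor>) ` H n (fst p) (snd p))))"
        unfolding of_nat_sum[symmetric] of_nat_le_iff .
      also have "\<dots> \<le> (\<Sum>p\<in>cylinder_starts b n \<times> {-1, 0, 1::int}. 2 * (e n / b ^ n / r n) + 2)"
        by (intro sum_mono cardH)
      also have "\<dots> = 3 * real (card (cylinder_starts b n)) * (2 * (e n / b ^ n / r n) + 2)"
        by (simp add: card_cartesian_product)
      also have "\<dots> \<le> 3 * (C1 * b ^ n) * (2 * (e n / b ^ n / r n) + 2)"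
        using card_cylinder_starts_le[OF b, of n] epos[of n] rpos[of n] b unfolding C1_def
        by (intro mult_right_mono mult_left_mono) auto
      also have "\<dots> = 6 * C1 * (e n / r n + b ^ n)" using b by (simp add: field_simps)
      also have "e n / r n = exp ((\<rho> - l) * real n)"
        by (simp add: e_def r_def exp_diff[symmetric] algebra_simps)
      also have "6 * C1 * (exp ((\<rho> - l) * real n) + b ^ n) \<le>
          6 * C1 * (exp (cover_exponent l b \<rho> * real n) + exp (cover_exponent l b \<rho> * real n))"
        unfolding bn cover_exponent_def using False C1
        by (intro mult_left_mono add_mono) (auto intro!: mult_right_mono)
      finally show ?thesis by simp
    qed
    then show thesis using that[of "12 * C1"] C1 finite_subset[OF sub finJ]
      unfolding D_def r_def by simp
  qed
qed

section \<open>Hausdorff measure estimates from covers\<close>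

context Metric_space
begin

lemma mdiameter_bounds:
  assumes "U \<subseteq> M" "x \<in> U" "\<And>x y. x \<in> U \<Longrightarrow> y \<in> U \<Longrightarrow> d x y \<le> r"
  shows "0 \<le> mdiameter U" "mdiameter U \<le> r" "\<And>x y. x \<in> U \<Longrightarrow> y \<in> U \<Longrightarrow> d x y \<le> mdiameter U"
proof -
  have up: "d x y \<le> mdiameter U" if "x \<in> U" "y \<in> U" for x y
  proof -
    have "bdd_above ((\<lambda>(x, y). d x y) ` (U \<times> U))" using assms(3) by (intro bdd_aboveI[of _ r]) auto
    then have "(case (x, y) of (x, y) \<Rightarrow> d x y) \<le> (SUP (x, y)\<in>U \<times> U. d x y)"
      using that by (intro cSUP_upper) auto
    then show ?thesis using that by (auto simp: mdiameter_def)
  qed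
  then show "\<And>x y. x \<in> U \<Longrightarrow> y \<in> U \<Longrightarrow> d x y \<le> mdiameter U" .
  show "0 \<le> mdiameter U" using up[OF assms(2,2)] nonneg[of x x] by linarith
  have "(SUP (x, y)\<in>U \<times> U. d x y) \<le> r" using assms by (intro cSUP_least) auto
  then show "mdiameter U \<le> r" using assms(2) by (auto simp: mdiameter_def)
qed

lemma hausdorff_gauge_le:
  assumes "0 < s" "U \<subseteq> M" "\<And>x y. x \<in> U \<Longrightarrow> y \<in> U \<Longrightarrow> d x y \<le> r"
  shows "hausdorff_gauge s U \<le> ennreal (r powr s)"
proof (cases "U = {}")
  case False
  then obtain x where "x \<in> U" by auto
  then show ?thesis using mdiameter_bounds[OF assms(2) _ assms(3)] assms(1) False
    by (auto simp: hausdorff_gauge_def intro!: ennreal_leI powr_mono2)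
qed (simp add: hausdorff_gauge_def)

lemma hausdorff_premeasure_le_suminf:
  fixes V :: "nat \<Rightarrow> 'b set" and U :: "nat \<Rightarrow> 'b \<Rightarrow> 'a set"
  assumes fin: "\<And>n. finite (V n)" and cov: "A \<subseteq> (\<Union>n. \<Union>v\<in>V n. U n v)"
    and sub: "\<And>n v. v \<in> V n \<Longrightarrow> U n v \<subseteq> M"
    and diam: "\<And>n v x y. v \<in> V n \<Longrightarrow> x \<in> U n v \<Longrightarrow> y \<in> U n v \<Longrightarrow> d x y \<le> \<delta>"
    and gauge: "\<And>n v. v \<in> V n \<Longrightarrow> hausdorff_gauge s (U n v) \<le> g n"
    and "0 \<le> \<delta>"
  shows "hausdorff_premeasure s \<delta> A \<le> (\<Sum>n. of_nat (card (V n)) * g n)"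
proof -
  have "\<exists>e. bij_betw e {0..<card (V n)} (V n)" for n using fin ex_bij_betw_nat_finite by blast
  then obtain e where e: "\<And>n. bij_betw (e n) {0..<card (V n)} (V n)" by metis
  define W where "W p = (case p of (n, k) \<Rightarrow> if k < card (V n) then U n (e n k) else {})" for p
  have eV: "e n k \<in> V n" if "k < card (V n)" for n k using e[of n] that by (auto simp: bij_betw_def)
  have "(\<lambda>p. W (prod_decode p)) \<in> delta_covers \<delta> A"
    unfolding delta_covers_def
  proof (safe)
    fix x assume "x \<in> A"
    then obtain n v where v: "v \<in> V n" "x \<in> U n v" using cov by auto
    then obtain k where "k < card (V n)" "v = e n k"
      using bij_betw_imp_surj_on[OF e[of n]] by (metis imageE atLeastLessThan_iff)
    then have "x \<in> W (prod_decode (prod_encode (n, k)))" using v by (simp add: W_def)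
    then show "x \<in> (\<Union>p. W (prod_decode p))" by blast
  next
    fix p x assume "x \<in> W (prod_decode p)"
    then show "x \<in> M" using sub eV by (fastforce simp: W_def split: prod.splits if_splits)
  next
    fix p x y assume "x \<in> W (prod_decode p)" "y \<in> W (prod_decode p)"
    then show "d x y \<le> \<delta>" using diam eV by (fastforce simp: W_def split: prod.splits if_splits)
  qed
  then have "hausdorff_premeasure s \<delta> A \<le> (\<Sum>p. hausdorff_gauge s (W (prod_decode p)))"
    unfolding hausdorff_premeasure_def by (intro INF_lower2) auto
  also have "\<dots> = (\<Sum>n. \<Sum>k. hausdorff_gauge s (W (n, k)))"
    by (rule suminf_ennreal_2dimen) auto
  also have "\<dots> \<le> (\<Sum>n. of_nat (card (V n)) * g n)"
  proof (intro suminf_le allI)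
    fix n
    have "(\<Sum>k. hausdorff_gauge s (W (n, k))) = (\<Sum>k<card (V n). hausdorff_gauge s (W (n, k)))"
      by (intro suminf_finite) (auto simp: W_def hausdorff_gauge_def)
    also have "\<dots> \<le> (\<Sum>k<card (V n). g n)"
      using gauge eV by (intro sum_mono) (auto simp: W_def)
    finally show "(\<Sum>k. hausdorff_gauge s (W (n, k))) \<le> of_nat (card (V n)) * g n" by simp
  qed auto
  finally show ?thesis .
qed

lemma hausdorff_dim_nonneg: "0 \<le> hausdorff_dim A"
  unfolding hausdorff_dim_def by (intro INF_greatest) auto

end

interpretation torus: Metric_space torus torus_dist
  by (rule Metric_space_torus)

text \<open>A point that hits infinitely often lies in the cover of some time
  \<open>n \<ge> N\<close>, for every \<open>N\<close>. At time \<open>n\<close> there are at most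
  \<open>K * exp (F * n)\<close> grid cubes of side \<open>exp (- \<rho> * n)\<close>, so for
  \<open>s > F / \<rho>\<close> the total gauge is a tail of a convergent geometric series.\<close>

lemma hausdorff_dim_targets_le:
  fixes b :: "'n::finite \<Rightarrow> real" and a :: "real ^ 'n"
  assumes b: "\<And>i. 1 < b i" and l: "0 \<le> l" and \<rho>: "0 < \<rho>" and a: "a \<in> torus"
    and W: "W \<subseteq> torus"
    and io: "\<And>x. x \<in> W \<Longrightarrow> infinite {n. \<forall>i. nint_dist ((beta_map (b i) ^^ n) (x $ i) - a $ i) \<le> exp (- l * real n)}"
  shows "torus_hausdorff_dim W \<le> ereal ((\<Sum>i\<in>UNIV. cover_exponent l (b i) \<rho>) / \<rho>)"
proof -
  define r where "r n = exp (- \<rho> * real n)" for n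
  define D where "D n i = {x. 0 \<le> x \<and> x < 1 \<and> nint_dist ((beta_map (b i) ^^ n) x - a $ i) \<le> exp (- l * real n)}" for n i
  define G where "G n i = (\<lambda>x. \<lfloor>x / r n\<rfloor>) ` D n i" for n i
  have "\<exists>C>0. \<forall>n. finite (G n i) \<and> real (card (G n i)) \<le> C * exp (cover_exponent l (b i) \<rho> * real n)" for i
  proof -
    have "0 \<le> a $ i" "a $ i < 1" using a by (auto simp: torus_def)
    from target_grid_count[OF b[of i] l \<rho> this] obtain C where "0 < C"
      "\<And>n. finite (G n i)" "\<And>n. real (card (G n i)) \<le> C * exp (cover_exponent l (b i) \<rho> * real n)"
      unfolding G_def D_def r_def by blast
    then show ?thesis by (intro exI[of _ C]) simp
  qed
  then obtain C where C: "\<And>i. 0 < C i" and finG: "\<And>n i. finite (G n i)" and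
    cardG: "\<And>n i. real (card (G n i)) \<le> C i * exp (cover_exponent l (b i) \<rho> * real n)"
    by metis
  define F where "F = (\<Sum>i\<in>UNIV. cover_exponent l (b i) \<rho>)"
  have "0 < cover_exponent l (b i) \<rho>" for i using b[of i] \<rho> by (simp add: cover_exponent_def less_max_iff_disj)
  then have F: "0 < F" unfolding F_def by (intro sum_pos) auto
  define K where "K = (\<Prod>i\<in>UNIV. C i)"
  have K: "0 < K" unfolding K_def using C by (intro prod_pos) auto
  define V where "V n = PiE UNIV (G n)" for n
  have finV: "finite (V n)" for n unfolding V_def using finG by (intro finite_PiE) auto
  have cardV: "real (card (V n)) \<le> K * exp (F * real n)" for n
  proof -
    have "real (card (V n)) = (\<Prod>i\<in>UNIV. real (card (G n i)))" unfolding V_def by (simp add: card_PiE)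
    also have "\<dots> \<le> (\<Prod>i\<in>UNIV. C i * exp (cover_exponent l (b i) \<rho> * real n))"
      using cardG by (intro prod_mono) auto
    finally show ?thesis by (simp add: prod.distrib exp_sum[symmetric] K_def F_def sum_distrib_right)
  qed
  define U where "U n v = {x :: real ^ 'n. x \<in> torus \<and> (\<forall>i. \<lfloor>x $ i / r n\<rfloor> = v i)}" for n v
  have rpos: "0 < r n" for n by (simp add: r_def)
  have diamU: "torus_dist x y \<le> r n" if xy: "x \<in> U n v" "y \<in> U n v" for n v x y
    unfolding torus_dist_le_iff
  proof
    fix i
    have "\<lfloor>x $ i / r n\<rfloor> = \<lfloor>y $ i / r n\<rfloor>" using xy by (auto simp: U_def)
    then have "\<bar>x $ i / r n - y $ i / r n\<bar> \<le> 1" by linarith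
    then have "\<bar>(x $ i - y $ i)\<bar> / r n \<le> 1" using rpos[of n] by (simp add: diff_divide_distrib[symmetric])
    then have "\<bar>x $ i - y $ i\<bar> \<le> r n" using rpos[of n] by (simp add: divide_le_eq)
    then show "nint_dist (x $ i - y $ i) \<le> r n" using nint_dist_le[of "x $ i - y $ i" 0] by simp
  qed
  have null: "torus.hausdorff_measure s W = 0" if s: "F / \<rho> < s" for s
  proof -
    have s0: "0 < s" using s F \<rho> by (meson divide_pos_pos less_trans)
    \<comment> \<open>The ratio of that geometric series; it is below 1 exactly because
      \<open>s > F / \<rho>\<close>.\<close>
    define q where "q = exp (F - \<rho> * s)"
    have q: "0 < q" "q < 1" using s \<rho> by (auto simp: q_def divide_less_eq mult.commute)
    have pre: "torus.hausdorff_premeasure s \<delta> W = 0" if \<delta>: "0 < \<delta>" for \<delta>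
    proof -
      have "r \<longlonglongrightarrow> 0" unfolding r_def using \<rho> by real_asymp
      then have "eventually (\<lambda>n. r n < \<delta>) sequentially" using \<delta> order_tendstoD(2) by blast
      then obtain N0 where N0: "\<And>n. N0 \<le> n \<Longrightarrow> r n < \<delta>" by (auto simp: eventually_sequentially)
      have bd: "torus.hausdorff_premeasure s \<delta> W \<le> ennreal (K / (1 - q) * q ^ N)" if N: "N0 \<le> N" for N
      proof -
        have "torus.hausdorff_premeasure s \<delta> W \<le> (\<Sum>n. of_nat (card (V (n + N))) * ennreal (r (n + N) powr s))"
        proof (rule torus.hausdorff_premeasure_le_suminf[where U = "\<lambda>n. U (n + N)"])
          show "W \<subseteq> (\<Union>n. \<Union>v\<in>V (n + N). U (n + N) v)"
          proof
            fix x assume x: "x \<in> W"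
            obtain n where n: "N \<le> n" "\<forall>i. nint_dist ((beta_map (b i) ^^ n) (x $ i) - a $ i) \<le> exp (- l * real n)"
              using io[OF x] unfolding infinite_nat_iff_unbounded_le by blast
            have xt: "x \<in> torus" using x W by auto
            then have "(\<lambda>i. \<lfloor>x $ i / r n\<rfloor>) \<in> V n"
              using n by (auto simp: V_def G_def D_def torus_def)
            moreover have "x \<in> U n (\<lambda>i. \<lfloor>x $ i / r n\<rfloor>)" using xt by (simp add: U_def)
            ultimately have "x \<in> (\<Union>v\<in>V ((n - N) + N). U ((n - N) + N) v)" using n by auto
            then show "x \<in> (\<Union>n. \<Union>v\<in>V (n + N). U (n + N) v)" by blast
          qed
          show "torus_dist x y \<le> \<delta>" if "v \<in> V (n + N)" "x \<in> U (n + N) v" "y \<in> U (n + N) v" for n v x y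
            using diamU[OF that(2,3)] N0[of "n + N"] N by linarith
          show "torus.hausdorff_gauge s (U (n + N) v) \<le> ennreal (r (n + N) powr s)" for n v
            by (rule torus.hausdorff_gauge_le[OF s0 _ diamU]) (auto simp: U_def)
        qed (use \<delta> finV in \<open>auto simp: U_def\<close>)
        also have "\<dots> \<le> (\<Sum>n. ennreal (K * q ^ N * q ^ n))"
        proof (intro suminf_le)
          fix n
          have "of_nat (card (V (n + N))) * ennreal (r (n + N) powr s) = ennreal (real (card (V (n + N))) * r (n + N) powr s)"
            by (simp add: ennreal_mult ennreal_of_nat_eq_real_of_nat)
          also have "\<dots> \<le> ennreal (K * exp (F * real (n + N)) * r (n + N) powr s)"
            by (intro ennreal_leI mult_right_mono cardV) auto
          also have "K * exp (F * real (n + N)) * r (n + N) powr s = K * q ^ (N + n)"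
            by (simp add: r_def powr_def q_def exp_of_nat_mult[symmetric] exp_add[symmetric] algebra_simps)
          finally show "of_nat (card (V (n + N))) * ennreal (r (n + N) powr s) \<le> ennreal (K * q ^ N * q ^ n)"
            by (simp add: power_add mult.assoc)
        qed auto
        also have "\<dots> = ennreal (\<Sum>n. K * q ^ N * q ^ n)"
          using q K by (intro suminf_ennreal2 summable_mult summable_geometric) auto
        also have "(\<Sum>n. K * q ^ N * q ^ n) = K / (1 - q) * q ^ N"
          using q by (subst suminf_mult) (auto intro: summable_geometric simp: suminf_geometric)
        finally show ?thesis .
      qed
      have "(\<lambda>N. K / (1 - q) * q ^ N) \<longlonglongrightarrow> K / (1 - q) * 0"
        using q by (intro tendsto_mult tendsto_const LIMSEQ_power_zero) auto
      then have "(\<lambda>N. ennreal (K / (1 - q) * q ^ N)) \<longlonglongrightarrow> ennreal 0" by (intro tendsto_ennrealI) simp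
      then have "torus.hausdorff_premeasure s \<delta> W \<le> ennreal 0"
        by (rule LIMSEQ_le_const) (use bd in blast)
      then show ?thesis by simp
    qed
    show ?thesis unfolding torus.hausdorff_measure_def using pre by (auto intro!: SUP_eq_const)
  qed
  have le: "torus_hausdorff_dim W \<le> ereal s" if "F / \<rho> < s" for s
  proof -
    have "0 < F / \<rho>" using F \<rho> by simp
    then show ?thesis unfolding torus.hausdorff_dim_def using null[OF that] that
      by (intro INF_lower) auto
  qed
  have "torus_hausdorff_dim W \<le> ereal (F / \<rho>)"
  proof (rule ereal_le_epsilon2)
    fix e :: real assume "0 < e"
    then show "torus_hausdorff_dim W \<le> ereal (F / \<rho>) + ereal e" using le[of "F / \<rho> + e"] by simp
  qed
  then show ?thesis by (simp add: F_def)
qed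

section \<open>The minimum of the exponent\<close>

lemma cover_exponent_le:
  assumes "0 \<le> l" "0 \<le> \<rho>" "1 < b"
  shows "cover_exponent l b \<rho> \<le> \<rho>"
  using assms by (auto simp: cover_exponent_def)

text \<open>The continuity in \<open>l\<close> that carries the upper bound, proved for
  \<open>l'\<close> below the lower order, to the lower order itself.\<close>

lemma cover_exponent_diff_le: "l' \<le> l \<Longrightarrow> cover_exponent l' b \<rho> \<le> cover_exponent l b \<rho> + (l - l')"
  by (auto simp: cover_exponent_def max_def)

lemma min_concave:
  fixes t p q c :: real
  assumes "0 \<le> t" "t \<le> 1"
  shows "(1 - t) * min p c + t * min q c \<le> min ((1 - t) * p + t * q) c"
proof (rule min.boundedI)
  show "(1 - t) * min p c + t * min q c \<le> (1 - t) * p + t * q"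
    using assms by (intro add_mono mult_left_mono) auto
  have "(1 - t) * min p c + t * min q c \<le> (1 - t) * c + t * c"
    using assms by (intro add_mono mult_left_mono) auto
  then show "(1 - t) * min p c + t * min q c \<le> c" by (simp add: algebra_simps)
qed

text \<open>
  As a function of \<open>\<rho>\<close>, the covering exponent is concave except for a kink at
  \<open>\<rho> = ln b + l\<close>. Hence the ratio of the total exponent to \<open>\<rho>\<close> is minimal at a kink.
\<close>
lemma cover_exponent_sum_ge:
  fixes b :: "'i \<Rightarrow> real"
  assumes I: "finite I" "I \<noteq> {}" and b: "\<And>i. i \<in> I \<Longrightarrow> 1 < b i" and l: "0 \<le> l" and \<rho>: "0 < \<rho>"
    and s: "\<And>i. i \<in> I \<Longrightarrow> s * (ln (b i) + l) \<le> (\<Sum>k\<in>I. cover_exponent l (b k) (ln (b i) + l))"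
  shows "s * \<rho> \<le> (\<Sum>k\<in>I. cover_exponent l (b k) \<rho>)"
proof -
  define kink where "kink i = ln (b i) + l" for i
  define g where "g x = (\<Sum>k\<in>I. cover_exponent l (b k) x) - s * x" for x
  have kpos: "0 < kink i" if "i \<in> I" for i using b[OF that] l by (simp add: kink_def add_pos_nonneg)
  have gk: "0 \<le> g (kink i)" if "i \<in> I" for i using s[OF that] by (simp add: g_def kink_def)
  have g0: "0 \<le> g 0"
    unfolding g_def cover_exponent_def using b l by (auto intro!: sum_nonneg simp: le_max_iff_disj)
  \<comment> \<open>The witness is the largest kink up to \<open>\<rho>\<close>, or 0 if there is
    none. No kink is left strictly above \<open>p\<close> and up to \<open>\<rho>\<close>.\<close>
  have "\<exists>p. 0 \<le> p \<and> p \<le> \<rho> \<and> 0 \<le> g p \<and> (\<forall>i\<in>I. kink i \<le> p \<or> \<rho> < kink i)"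
  proof (cases "{i \<in> I. kink i \<le> \<rho>} = {}")
    case True
    then show ?thesis using g0 \<rho> by (intro exI[of _ 0]) force
  next
    case False
    define p where "p = Max (kink ` {i \<in> I. kink i \<le> \<rho>})"
    have fin: "finite (kink ` {i \<in> I. kink i \<le> \<rho>})" using I by auto
    then have "p \<in> kink ` {i \<in> I. kink i \<le> \<rho>}" unfolding p_def using False by (intro Max_in) auto
    moreover have "kink i \<le> p" if "i \<in> I" "kink i \<le> \<rho>" for i
      unfolding p_def using fin that by (intro Max_ge) auto
    ultimately show ?thesis using gk kpos by (intro exI[of _ p]) (force simp: less_imp_le not_le)
  qed
  then obtain p where p: "0 \<le> p" "p \<le> \<rho>" "0 \<le> g p" "\<And>i. i \<in> I \<Longrightarrow> kink i \<le> p \<or> \<rho> < kink i" by auto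
  have above: "cover_exponent l (b i) x = x - l" if "i \<in> I" "kink i \<le> x" for i x
    using that l by (auto simp: kink_def cover_exponent_def)
  have below: "cover_exponent l (b i) x = min x (ln (b i))" if "i \<in> I" "x \<le> kink i" for i x
    using that l by (auto simp: kink_def cover_exponent_def)
  show ?thesis
  proof (cases "{i \<in> I. \<rho> < kink i} = {}")
    case True
    then have all: "kink i \<le> p" if "i \<in> I" for i using p that by auto
    have eq: "(\<Sum>k\<in>I. cover_exponent l (b k) \<rho>) = (\<Sum>k\<in>I. cover_exponent l (b k) p) + card I * (\<rho> - p)"
    proof -
      have "cover_exponent l (b k) \<rho> = cover_exponent l (b k) p + (\<rho> - p)" if "k \<in> I" for k
        using above[OF that, of p] above[OF that, of \<rho>] all[OF that] p(2) by simp
      then have "(\<Sum>k\<in>I. cover_exponent l (b k) \<rho>) = (\<Sum>k\<in>I. cover_exponent l (b k) p + (\<rho> - p))"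
        by (rule sum.cong[OF refl])
      then show ?thesis by (simp add: sum.distrib)
    qed
    obtain i where i: "i \<in> I" using I by auto
    \<comment> \<open>Beyond the last kink every exponent has slope 1, so the sum has slope
      \<open>card I\<close>. As an exponent never exceeds its argument, the hypothesis at any kink
      forces \<open>s \<le> card I\<close>, and \<open>g\<close> does not decrease.\<close>
    have "s * kink i \<le> (\<Sum>k\<in>I. kink i)"
      using order_trans[OF s[OF i] sum_mono[OF cover_exponent_le]] l b kpos[OF i] by (simp add: kink_def)
    then have "s \<le> card I" using kpos[OF i] by simp
    then have "s * (\<rho> - p) \<le> card I * (\<rho> - p)" using p by (intro mult_right_mono) auto
    then show ?thesis using p(3) eq unfolding g_def by (simp add: algebra_simps)
  next
    case False
    define q where "q = Min (kink ` {i \<in> I. \<rho> < kink i})"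
    have fin: "finite (kink ` {i \<in> I. \<rho> < kink i})" using I by auto
    then have "q \<in> kink ` {i \<in> I. \<rho> < kink i}" unfolding q_def using False by (intro Min_in) auto
    then have q: "\<rho> < q" "0 \<le> g q" using gk by auto
    have qmin: "q \<le> kink i" if "i \<in> I" "\<rho> < kink i" for i
      unfolding q_def using fin that by (intro Min_le) auto
    \<comment> \<open>\<open>\<rho>\<close> is a convex combination of \<open>p\<close> and the next
      kink \<open>q\<close>. On this stretch each exponent is affine or a minimum with a constant,
      hence concave, so \<open>g\<close> lies above its chord, which is nonnegative at both
      ends.\<close>
    define t where "t = (\<rho> - p) / (q - p)"
    have t: "0 \<le> t" "t \<le> 1" using p q by (auto simp: t_def divide_le_eq)
    have "t * (q - p) = \<rho> - p" using p q by (simp add: t_def)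
    then have \<rho>eq: "\<rho> = (1 - t) * p + t * q" by (simp add: algebra_simps)
    have "(1 - t) * cover_exponent l (b i) p + t * cover_exponent l (b i) q \<le> cover_exponent l (b i) \<rho>"
      if i: "i \<in> I" for i
    proof (cases "kink i \<le> p")
      case True
      then have "cover_exponent l (b i) p = p - l" "cover_exponent l (b i) q = q - l"
        "cover_exponent l (b i) \<rho> = \<rho> - l" using above i p q by auto
      moreover have "(1 - t) * (p - l) + t * (q - l) = \<rho> - l" using \<rho>eq by (simp add: algebra_simps)
      ultimately show ?thesis by simp
    next
      case False
      then have "q \<le> kink i" using p(4)[OF i] qmin i by auto
      then have "cover_exponent l (b i) p = min p (ln (b i))" "cover_exponent l (b i) q = min q (ln (b i))"
        "cover_exponent l (b i) \<rho> = min \<rho> (ln (b i))" using below i p q by auto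
      then show ?thesis using min_concave[OF t, of p "ln (b i)" q] \<rho>eq by simp
    qed
    then have "(\<Sum>i\<in>I. (1 - t) * cover_exponent l (b i) p + t * cover_exponent l (b i) q) \<le> (\<Sum>i\<in>I. cover_exponent l (b i) \<rho>)"
      by (rule sum_mono)
    then have "(1 - t) * (\<Sum>i\<in>I. cover_exponent l (b i) p) + t * (\<Sum>i\<in>I. cover_exponent l (b i) q) \<le> (\<Sum>i\<in>I. cover_exponent l (b i) \<rho>)"
      by (simp add: sum.distrib sum_distrib_left)
    moreover have "0 \<le> (1 - t) * g p + t * g q" using t p q by simp
    moreover have "s * \<rho> = (1 - t) * (s * p) + t * (s * q)" by (subst \<rho>eq) (simp add: algebra_simps)
    ultimately show ?thesis unfolding g_def by (simp add: algebra_simps)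
  qed
qed

text \<open>At \<open>\<rho> = ln (\<beta> i) + l\<close> the second branch of the maximum equals
  \<open>ln (\<beta> i)\<close>. It wins for \<open>k \<le> i\<close>; for \<open>k > i\<close> the
  exponent is \<open>ln (\<beta> k)\<close> cut off at \<open>\<rho>\<close>, and the cut-off excess
  is the sum subtracted in \<open>theta\<close>.\<close>

lemma theta_eq_cover_exponent:
  assumes \<beta>: "\<And>i. i \<in> {1..d} \<Longrightarrow> 1 < \<beta> i" and mono: "mono_on {1..d} \<beta>" and i: "i \<in> {1..d}" and l: "0 \<le> l"
  shows "theta d \<beta> i (ereal l) = (\<Sum>k\<in>{1..d}. cover_exponent l (\<beta> k) (ln (\<beta> i) + l)) / (ln (\<beta> i) + l)"
proof -
  have bi: "1 < \<beta> i" using \<beta> i by auto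
  have lnge: "\<beta> k > \<beta> i * exp l \<longleftrightarrow> ln (\<beta> k) > ln (\<beta> i) + l" if "k \<in> {1..d}" for k
  proof -
    have "0 < \<beta> k" using \<beta>[OF that] by simp
    then show ?thesis using bi by (subst ln_less_cancel_iff[symmetric]) (auto simp: ln_mult)
  qed
  have each: "cover_exponent l (\<beta> k) (ln (\<beta> i) + l) = (if k \<le> i then ln (\<beta> i) else ln (\<beta> k))
       - (if \<beta> k > \<beta> i * exp l then ln (\<beta> k) - ln (\<beta> i) - l else 0)" if k: "k \<in> {1..d}" for k
  proof (cases "k \<le> i")
    case True
    then have "\<beta> k \<le> \<beta> i" using mono k i by (auto simp: mono_on_def)
    then have "ln (\<beta> k) \<le> ln (\<beta> i)" using \<beta>[OF k] bi by simp
    then show ?thesis using True l lnge[OF k] by (auto simp: cover_exponent_def)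
  next
    case False
    then have "\<beta> i \<le> \<beta> k" using mono k i by (auto simp: mono_on_def)
    then have "ln (\<beta> i) \<le> ln (\<beta> k)" using \<beta>[OF k] bi by simp
    then show ?thesis using False l lnge[OF k] by (auto simp: cover_exponent_def)
  qed
  have "(\<Sum>k\<in>{1..d}. cover_exponent l (\<beta> k) (ln (\<beta> i) + l)) =
    (\<Sum>k\<in>{1..d}. if k \<le> i then ln (\<beta> i) else ln (\<beta> k)) - (\<Sum>k\<in>{1..d}. if \<beta> k > \<beta> i * exp l then ln (\<beta> k) - ln (\<beta> i) - l else 0)"
    using each by (simp add: sum_subtractf)
  also have "(\<Sum>k\<in>{1..d}. if k \<le> i then ln (\<beta> i) else ln (\<beta> k)) = (\<Sum>k\<in>{1..i}. ln (\<beta> i)) + (\<Sum>k\<in>{i<..d}. ln (\<beta> k))"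
  proof -
    have "{1..d} = {1..i} \<union> {i<..d}" using i by auto
    then show ?thesis by (simp only:) (subst sum.union_disjoint, auto intro!: sum.cong)
  qed
  also have "(\<Sum>k\<in>{1..d}. if \<beta> k > \<beta> i * exp l then ln (\<beta> k) - ln (\<beta> i) - l else 0) =
    (\<Sum>k | k \<in> {1..d} \<and> \<beta> k > \<beta> i * exp l. ln (\<beta> k) - ln (\<beta> i) - l)"
    by (simp add: sum.inter_filter[symmetric])
  finally show ?thesis by (simp add: theta_def algebra_simps)
qed

section \<open>Eigenvalues and coordinates of a diagonal matrix\<close>

lemma image_mset_eq_of_prod_linear_eq:
  fixes f :: "'a \<Rightarrow> real" and g :: "'b \<Rightarrow> real"
  assumes "finite A" "finite B" and eq: "\<And>x. (\<Prod>i\<in>A. x - f i) = (\<Prod>i\<in>B. x - g i)"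
  shows "image_mset f (mset_set A) = image_mset g (mset_set B)"
proof -
  have roots: "proots (\<Prod>i\<in>C. [:- h i, 1:]) = image_mset h (mset_set C)" if "finite C" for C :: "'c set" and h :: "'c \<Rightarrow> real"
    using that by (induction C rule: finite_induct) (simp_all add: proots_mult del: mult_pCons_left)
  have "poly (\<Prod>i\<in>A. [:- f i, 1:]) = poly (\<Prod>i\<in>B. [:- g i, 1:])"
    using eq by (simp add: poly_prod fun_eq_iff)
  then have "(\<Prod>i\<in>A. [:- f i, 1:]) = (\<Prod>i\<in>B. [:- g i, 1:])" by (simp add: poly_eq_poly_eq_iff)
  then show ?thesis using roots[OF assms(1), of f] roots[OF assms(2), of g] by simp
qed

text \<open>The characteristic polynomial determines the diagonal entries only as a multiset. That
  suffices, since they enter the dimension through sums over all coordinates.\<close>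

lemma eigenvalues_of_diagonal_matrix:
  fixes T :: "real ^ 'n ^ 'n"
  assumes "diagonal_matrix T" "eigenvalues_of T \<beta>"
  shows "image_mset (\<lambda>i. T $ i $ i) (mset_set UNIV) = image_mset \<beta> (mset_set {1..CARD('n)})"
proof (rule image_mset_eq_of_prod_linear_eq)
  fix x
  have "det (mat x - T) = (\<Prod>i\<in>UNIV. (mat x - T) $ i $ i)"
    using assms(1) by (intro det_diagonal) (auto simp: diagonal_matrix_def mat_def)
  then show "(\<Prod>i\<in>UNIV. x - T $ i $ i) = (\<Prod>i = 1..CARD('n). x - \<beta> i)"
    using assms(2) by (simp add: eigenvalues_of_def mat_def)
qed auto

lemma torus_map_funpow_diagonal:
  fixes T :: "real ^ 'n ^ 'n"
  assumes "diagonal_matrix T"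
  shows "(torus_map T ^^ n) x $ i = (beta_map (T $ i $ i) ^^ n) (x $ i)"
proof (induction n)
  case (Suc n)
  have "(T *v y) $ i = T $ i $ i * y $ i" for y
  proof -
    have "T $ i $ j * y $ j = (if j = i then T $ i $ i * y $ i else 0)" for j
      using assms by (cases "j = i") (auto simp: diagonal_matrix_def)
    then have "(T *v y) $ i = (\<Sum>j\<in>UNIV. if j = i then T $ i $ i * y $ i else 0)"
      unfolding matrix_vector_mult_def vec_lambda_beta by (rule sum.cong[OF refl])
    then show ?thesis by simp
  qed
  then show ?case using Suc by (simp add: torus_map_def beta_map_def)
qed simp

section \<open>Towers of full branches\<close>

text \<open>Provides the steering branch. Its length is about \<open>\<mu> * n / ln b\<close>, so
  its cylinders are shorter than the target by the factor
  \<open>exp ((\<mu> - \<kappa>) * n)\<close>, which outgrows the linear factor demanded by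
  \<open>full_branch_in_interval\<close>.\<close>

lemma full_branch_in_target:
  assumes b: "1 < b" and \<kappa>: "0 \<le> \<kappa>" "\<kappa> < \<mu>" and a: "0 \<le> a" "a < 1"
  shows "\<exists>N. \<forall>n\<ge>N. \<exists>l c. c \<in> full_branches b l \<and> b ^ (l + 1) \<le> exp (\<mu> * real n) \<and>
           (\<forall>y. c \<le> y \<and> y < c + 1 / b ^ l \<longrightarrow> nint_dist (y - a) \<le> exp (- \<kappa> * real n))"
proof -
  have lnb: "0 < ln b" using b by simp
  define \<epsilon> where "\<epsilon> = \<mu> - \<kappa>"
  have \<epsilon>: "0 < \<epsilon>" "0 < \<mu>" using \<kappa> by (auto simp: \<epsilon>_def)
  define L where "L = \<mu> / ln b"
  \<comment> \<open>One factor 2 pays for halving the radius, one for the factor in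
    \<open>2 * Suc l\<close>, and \<open>b ^ 2\<close> for rounding \<open>L * n\<close> down to
    \<open>l\<close>.\<close>
  define B where "B = 4 * b ^ 2"
  have L: "0 < L" and B: "0 < B" using \<epsilon> lnb b by (auto simp: L_def B_def)
  have "eventually (\<lambda>n. L * real n < exp (\<epsilon> * real n) / B) sequentially"
    using \<epsilon>(1) L B by real_asymp
  moreover have "eventually (\<lambda>n. 2 < L * real n) sequentially" using L by real_asymp
  ultimately have "eventually (\<lambda>n. L * real n < exp (\<epsilon> * real n) / B \<and> 2 < L * real n) sequentially"
    by (rule eventually_conj)
  then obtain N where N: "\<And>n. N \<le> n \<Longrightarrow> L * real n < exp (\<epsilon> * real n) / B" "\<And>n. N \<le> n \<Longrightarrow> 2 < L * real n"
    by (auto simp: eventually_sequentially)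
  show ?thesis
  proof (rule exI[of _ N], intro allI impI)
    fix n assume n: "N \<le> n"
    \<comment> \<open>The 1 subtracted leaves room for the extra unit of time that follows each
      steering branch.\<close>
    define l where "l = nat \<lfloor>L * real n\<rfloor> - 1"
    have "2 \<le> \<lfloor>L * real n\<rfloor>" using N(2)[OF n] by linarith
    then have l: "real l + 1 \<le> L * real n" "L * real n < real l + 2" unfolding l_def by linarith+
    have bexp: "b powr (L * real n) = exp (\<mu> * real n)" using b lnb by (simp add: powr_def L_def)
    have "b ^ (l + 1) = b powr (real l + 1)" using powr_realpow[of b "l + 1"] b by (simp add: add.commute)
    also have "\<dots> \<le> b powr (L * real n)" using l(1) b by (intro powr_mono) auto
    finally have upper: "b ^ (l + 1) \<le> exp (\<mu> * real n)" by (simp add: bexp)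
    have "exp (\<mu> * real n) \<le> b powr (real l + 2)" unfolding bexp[symmetric] using l(2) b by (intro powr_mono) auto
    also have "\<dots> = b ^ (l + 2)" using powr_realpow[of b "l + 2"] b by (simp add: add.commute)
    finally have lower: "exp (\<mu> * real n) \<le> b ^ l * b ^ 2" by (simp add: power_add power2_eq_square mult_ac)
    define r where "r = exp (- \<kappa> * real n) / 2"
    have "exp (- \<kappa> * real n) \<le> 1" using \<kappa> by simp
    then have r: "0 \<le> r" "r \<le> 1 / 2" "r \<le> exp (- \<kappa> * real n)" by (auto simp: r_def)
    have "2 * real (Suc l) \<le> 2 * (L * real n)" using l(1) by simp
    also have "\<dots> < 2 * (exp (\<epsilon> * real n) / B)" using N(1)[OF n] by simp
    also have "\<dots> = r * (exp (\<mu> * real n) / b ^ 2)"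
      using b by (simp add: r_def B_def \<epsilon>_def field_simps exp_add[symmetric])
    also have "\<dots> \<le> r * b ^ l" using lower r b by (intro mult_left_mono) (auto simp: divide_le_eq)
    finally have large: "2 * real (Suc l) < r * b ^ l" .
    \<comment> \<open>A one-sided interval with endpoint \<open>a\<close>: since
      \<open>r \<le> 1 / 2\<close>, one of the two sides stays in the unit interval and no
      wrap-around occurs.\<close>
    define x where "x = (if a \<le> 1 / 2 then a else a - r)"
    have x: "0 \<le> x" "x + r \<le> 1" "x \<le> a" "a \<le> x + r" using a r by (auto simp: x_def)
    obtain c where c: "c \<in> full_branches b l" "x \<le> c" "c + 1 / b ^ l \<le> x + r"
      using full_branch_in_interval[OF b x(1,2) r(1) large] by blast
    have "nint_dist (y - a) \<le> exp (- \<kappa> * real n)" if "c \<le> y" "y < c + 1 / b ^ l" for y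
    proof -
      have "\<bar>y - a\<bar> \<le> r" using that c x by linarith
      then show ?thesis using nint_dist_le[of "y - a" 0] r by simp
    qed
    then show "\<exists>l c. c \<in> full_branches b l \<and> b ^ (l + 1) \<le> exp (\<mu> * real n) \<and>
           (\<forall>y. c \<le> y \<and> y < c + 1 / b ^ l \<longrightarrow> nint_dist (y - a) \<le> exp (- \<kappa> * real n))"
      using c upper by blast
  qed
qed

text \<open>
  A point is built in stages. In stage \<open>j\<close>, times from \<open>stage_start \<nu> l j\<close> to \<open>\<nu> j\<close> are filled
  with an arbitrary full branch and then \<open>l j\<close> further times with a fixed branch, which steers the
  orbit into the target at time \<open>\<nu> j\<close>. The extra unit of time is filled with the
  leftmost branch and keeps the limit point away from the excluded right endpoints.
\<close>
fun stage_start :: "(nat \<Rightarrow> nat) \<Rightarrow> (nat \<Rightarrow> nat) \<Rightarrow> nat \<Rightarrow> nat" where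
  "stage_start \<nu> l 0 = 0"
| "stage_start \<nu> l (Suc j) = \<nu> j + l j + 1"

locale target_tower =
  fixes b :: real and \<nu> l :: "nat \<Rightarrow> nat" and c :: "nat \<Rightarrow> real"
  assumes b: "1 < b"
    and steer: "\<And>j. c j \<in> full_branches b (l j)"
    and stage_start_le: "\<And>j. stage_start \<nu> l j \<le> \<nu> j"
begin

abbreviation "start \<equiv> stage_start \<nu> l"

definition stage_choices :: "nat \<Rightarrow> real set" where
  "stage_choices j = full_branches b (\<nu> j - start j)"

fun tower :: "(nat \<Rightarrow> real) \<Rightarrow> nat \<Rightarrow> real" where
  "tower \<omega> 0 = 0"
| "tower \<omega> (Suc j) = tower \<omega> j + \<omega> j / b ^ start j + c j / b ^ \<nu> j"

text \<open>The left endpoint of the cylinder of order \<open>\<nu> j\<close>, after the free part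
  of stage \<open>j\<close> and before its steering branch. It depends on
  \<open>\<omega> 0, ..., \<omega> j\<close> only.\<close>

definition half_tower :: "(nat \<Rightarrow> real) \<Rightarrow> nat \<Rightarrow> real" where
  "half_tower \<omega> j = tower \<omega> j + \<omega> j / b ^ start j"

definition tower_point :: "(nat \<Rightarrow> real) \<Rightarrow> real" where
  "tower_point \<omega> = (SUP j. tower \<omega> j)"

lemma tower_mem:
  assumes "\<And>j. \<omega> j \<in> stage_choices j"
  shows "tower \<omega> j \<in> full_branches b (start j)"
    and "half_tower \<omega> j \<in> full_branches b (\<nu> j)"
    and "tower \<omega> (Suc j) \<in> full_branches b (\<nu> j + l j)"
proof -
  have half: "half_tower \<omega> j \<in> full_branches b (\<nu> j)" if "tower \<omega> j \<in> full_branches b (start j)" for j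
    using full_branches_comp[OF that assms[of j, unfolded stage_choices_def]] stage_start_le[of j]
    by (simp add: half_tower_def)
  have nxt: "tower \<omega> (Suc j) \<in> full_branches b (\<nu> j + l j)" if "tower \<omega> j \<in> full_branches b (start j)" for j
    using full_branches_comp[OF half[OF that] steer[of j]] by (simp add: half_tower_def)
  show mem: "tower \<omega> j \<in> full_branches b (start j)" for j
  proof (induction j)
    case 0 then show ?case using full_branches_zero[OF b] by simp
  next
    case (Suc j)
    then show ?case using nxt[OF Suc] full_branches_mono[OF b, of "\<nu> j + l j" "start (Suc j)"] by auto
  qed
  show "half_tower \<omega> j \<in> full_branches b (\<nu> j)" "tower \<omega> (Suc j) \<in> full_branches b (\<nu> j + l j)"
    using half nxt mem by blast+
qed

lemma tower_step:
  assumes \<omega>: "\<And>j. \<omega> j \<in> stage_choices j"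
  shows "tower \<omega> j \<le> half_tower \<omega> j" "half_tower \<omega> j \<le> tower \<omega> (Suc j)"
    and "tower \<omega> (Suc j) + 1 / b ^ (\<nu> j + l j) \<le> half_tower \<omega> j + 1 / b ^ \<nu> j"
    and "half_tower \<omega> j + 1 / b ^ \<nu> j \<le> tower \<omega> j + 1 / b ^ start j"
    and "1 / b ^ start (Suc j) < 1 / b ^ (\<nu> j + l j)"
proof -
  have pos: "0 < b ^ n" for n using b by simp
  have "0 \<le> \<omega> j" using full_branches_ge[OF b] \<omega>[of j] by (auto simp: stage_choices_def)
  then show "tower \<omega> j \<le> half_tower \<omega> j" unfolding half_tower_def using pos[of "start j"] by simp
  have "0 \<le> c j" using full_branches_ge[OF b] steer by auto
  then show "half_tower \<omega> j \<le> tower \<omega> (Suc j)" unfolding half_tower_def using pos[of "\<nu> j"] by simp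
  have "(c j + 1 / b ^ l j) / b ^ \<nu> j \<le> 1 / b ^ \<nu> j"
    using full_branches_le[OF b steer[of j]] pos[of "\<nu> j"] by (intro divide_right_mono) auto
  then show "tower \<omega> (Suc j) + 1 / b ^ (\<nu> j + l j) \<le> half_tower \<omega> j + 1 / b ^ \<nu> j"
    unfolding half_tower_def by (simp add: add_divide_distrib power_add mult.commute)
  have "(\<omega> j + 1 / b ^ (\<nu> j - start j)) / b ^ start j \<le> 1 / b ^ start j"
    using full_branches_le[OF b \<omega>[of j, unfolded stage_choices_def]] pos[of "start j"]
    by (intro divide_right_mono) auto
  moreover have "b ^ (\<nu> j - start j) * b ^ start j = b ^ \<nu> j"
    using stage_start_le[of j] by (simp add: power_add[symmetric])
  ultimately show "half_tower \<omega> j + 1 / b ^ \<nu> j \<le> tower \<omega> j + 1 / b ^ start j"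
    unfolding half_tower_def by (simp add: add_divide_distrib)
  show "1 / b ^ start (Suc j) < 1 / b ^ (\<nu> j + l j)"
    using b by (intro divide_strict_left_mono power_strict_increasing) auto
qed

text \<open>The cylinders are nested: left endpoints increase, right endpoints decrease, and the
  supremum lies in all the closed cylinders. The strict bound comes from the extra unit of time in
  \<open>start (Suc j)\<close>.\<close>

lemma tower_point_bounds:
  assumes \<omega>: "\<And>j. \<omega> j \<in> stage_choices j"
  shows "tower \<omega> j \<le> tower_point \<omega>" "tower_point \<omega> \<le> tower \<omega> j + 1 / b ^ start j"
    and "half_tower \<omega> j \<le> tower_point \<omega>" "tower_point \<omega> \<le> half_tower \<omega> j + 1 / b ^ \<nu> j"
    and "tower_point \<omega> < tower \<omega> (Suc j) + 1 / b ^ (\<nu> j + l j)"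
proof -
  note step = tower_step[OF \<omega>]
  have "tower \<omega> k \<le> tower \<omega> (Suc k)" for k using step(1,2)[of k] by linarith
  then have mono: "m \<le> k \<Longrightarrow> tower \<omega> m \<le> tower \<omega> k" for m k by (rule lift_Suc_mono_le)
  have "tower \<omega> (Suc k) + 1 / b ^ start (Suc k) \<le> tower \<omega> k + 1 / b ^ start k" for k
    using step(3-5)[of k] by linarith
  then have anti: "m \<le> k \<Longrightarrow> tower \<omega> k + 1 / b ^ start k \<le> tower \<omega> m + 1 / b ^ start m" for m k
    by (rule lift_Suc_antimono_le)
  have bd: "tower \<omega> k \<le> tower \<omega> m + 1 / b ^ start m" for k m
  proof (cases "m \<le> k")
    case True
    have "0 \<le> 1 / b ^ start k" using b by simp
    then show ?thesis using anti[OF True] by linarith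
  next
    case False
    have "0 \<le> 1 / b ^ start m" using b by simp
    then show ?thesis using mono[of k m] False by linarith
  qed
  have bdd: "bdd_above (range (tower \<omega>))" using bd[of _ 0] by (intro bdd_aboveI[of _ "tower \<omega> 0 + 1 / b ^ start 0"]) auto
  show low: "tower \<omega> j \<le> tower_point \<omega>" for j unfolding tower_point_def using bdd by (intro cSUP_upper) auto
  show up: "tower_point \<omega> \<le> tower \<omega> j + 1 / b ^ start j" for j unfolding tower_point_def using bd by (intro cSUP_least) auto
  show "half_tower \<omega> j \<le> tower_point \<omega>" using low[of "Suc j"] step(2)[of j] by linarith
  show "tower_point \<omega> < tower \<omega> (Suc j) + 1 / b ^ (\<nu> j + l j)" using up[of "Suc j"] step(5)[of j] by linarith
  then show "tower_point \<omega> \<le> half_tower \<omega> j + 1 / b ^ \<nu> j" using step(3)[of j] by linarith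
qed

lemma tower_point_in_unit:
  assumes \<omega>: "\<And>j. \<omega> j \<in> stage_choices j"
  shows "0 \<le> tower_point \<omega>" "tower_point \<omega> < 1"
  using tower_point_bounds(1)[OF \<omega>, of 0] tower_point_bounds(5)[OF \<omega>, of 0]
    full_branches_le[OF b tower_mem(3)[OF \<omega>, of 0]] by (simp, linarith)

lemma tower_point_hits:
  assumes \<omega>: "\<And>j. \<omega> j \<in> stage_choices j"
  shows "c j \<le> (beta_map b ^^ \<nu> j) (tower_point \<omega>)"
    "(beta_map b ^^ \<nu> j) (tower_point \<omega>) < c j + 1 / b ^ l j"
proof -
  have pos: "0 < b ^ n" for n using b by simp
  \<comment> \<open>The image of the limit point at time \<open>\<nu> j + l j\<close>. Being
    strictly below 1, it is in the domain of the steering branch, which carries it back to time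
    \<open>\<nu> j\<close>.\<close>
  define z where "z = (tower_point \<omega> - tower \<omega> (Suc j)) * b ^ (\<nu> j + l j)"
  have "tower_point \<omega> - tower \<omega> (Suc j) < 1 / b ^ (\<nu> j + l j)"
    using tower_point_bounds(5)[OF \<omega>, of j] by linarith
  then have z: "0 \<le> z" "z < 1"
    using tower_point_bounds(1)[OF \<omega>, of "Suc j"] pos[of "\<nu> j + l j"]
    by (auto simp: z_def pos_less_divide_eq)
  define y where "y = c j + z / b ^ l j"
  have y: "0 \<le> y" "y < 1" using full_branchesD[OF steer z] by (auto simp: y_def)
  have "tower_point \<omega> = tower \<omega> (Suc j) + z / b ^ (\<nu> j + l j)" using b by (simp add: z_def)
  also have "\<dots> = half_tower \<omega> j + y / b ^ \<nu> j"
    by (simp add: half_tower_def y_def add_divide_distrib power_add mult.commute)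
  finally have "(beta_map b ^^ \<nu> j) (tower_point \<omega>) = y"
    using full_branchesD(3)[OF tower_mem(2)[OF \<omega>] y] by simp
  then show "c j \<le> (beta_map b ^^ \<nu> j) (tower_point \<omega>)"
    "(beta_map b ^^ \<nu> j) (tower_point \<omega>) < c j + 1 / b ^ l j"
    using z pos[of "l j"] by (auto simp: y_def intro: divide_strict_right_mono)
qed

text \<open>Choices are recovered from the last stage backwards: the steering shifts do not depend
  on \<open>\<omega>\<close> and cancel, and an iterate separates \<open>\<omega> j\<close> from
  \<open>tower \<omega> j\<close>. Hence counting half towers counts initial choices.\<close>

lemma half_tower_inj:
  assumes "\<And>j. \<omega> j \<in> stage_choices j" "\<And>j. \<omega>' j \<in> stage_choices j"
    and "half_tower \<omega> j = half_tower \<omega>' j" and "k \<le> j"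
  shows "\<omega> k = \<omega>' k"
proof -
  have split: "tower \<omega> j = tower \<omega>' j \<and> \<omega> j = \<omega>' j" if "half_tower \<omega> j = half_tower \<omega>' j" for j
  proof (rule full_branches_comp_inj[OF b tower_mem(1)[OF assms(1)] tower_mem(1)[OF assms(2)]])
    show "0 \<le> \<omega> j" "0 \<le> \<omega>' j" using assms(1,2)[of j] full_branches_ge[OF b] by (auto simp: stage_choices_def)
    show "\<omega> j < 1" "\<omega>' j < 1"
      using full_branchesD(2)[of _ b _ 0] assms(1,2)[of j] by (fastforce simp: stage_choices_def)+
    show "tower \<omega> j + \<omega> j / b ^ start j = tower \<omega>' j + \<omega>' j / b ^ start j"
      using that by (simp add: half_tower_def)
  qed
  from assms(3,4) show ?thesis
  proof (induction j arbitrary: k)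
    case 0
    then show ?case using split[of 0] by simp
  next
    case (Suc j)
    have "half_tower \<omega> j = half_tower \<omega>' j" using split[OF Suc.prems(1)] by (simp add: half_tower_def)
    then show ?case using Suc split[OF Suc.prems(1)] by (cases "k = Suc j") auto
  qed
qed

end

section \<open>Counting cylinders near a ball and bounding their mass\<close>

lemma card_branches_near_le:
  assumes b: "1 < b" and u: "0 \<le> u" "u < 1" and r: "0 \<le> r"
  shows "real (card {y \<in> full_branches b n. \<exists>x. 0 \<le> x \<and> x < 1 \<and> y \<le> x \<and> x \<le> y + 1 / b ^ n \<and> nint_dist (x - u) \<le> r})
           \<le> 6 * (r * b ^ n + 1)" (is "real (card ?S) \<le> _")
proof -
  have pos: "0 < b ^ n" using b by simp
  define Q where "Q m = full_branches b n \<inter> {u + of_int m - r - 1 / b ^ n..u + of_int m + r}" for m :: int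
  have fin: "finite (Q m)" for m unfolding Q_def using finite_full_branches[OF b] by auto
  have cardQ: "real (card (Q m)) \<le> 2 * (r * b ^ n + 1)" for m
  proof -
    have "0 \<le> 1 / b ^ n" using pos by simp
    then have "u + of_int m - r - 1 / b ^ n \<le> u + of_int m + r" using r by linarith
    then have "real (card (Q m)) \<le> (u + of_int m + r - (u + of_int m - r - 1 / b ^ n)) / (1 / b ^ n) + 1"
      by (intro card_separated_le(2)) (use pos full_branches_separated[OF b] in \<open>auto simp: Q_def\<close>)
    also have "\<dots> = 2 * (r * b ^ n + 1)" using b by (simp add: field_simps)
    finally show ?thesis .
  qed
  have "?S \<subseteq> (\<Union>m\<in>{-1, 0, 1}. Q m)"
  proof
    fix y assume "y \<in> ?S"
    then obtain x where y: "y \<in> full_branches b n" and x: "0 \<le> x" "x < 1" "y \<le> x" "x \<le> y + 1 / b ^ n" "nint_dist (x - u) \<le> r" by auto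
    have "\<bar>x - u\<bar> \<le> 1" using x u by linarith
    then obtain m :: int where m: "m \<in> {-1, 0, 1}" "\<bar>x - u - of_int m\<bar> \<le> r" using nint_dist_leE x(5) by blast
    then have "y \<in> Q m" unfolding Q_def using x y by auto
    then show "y \<in> (\<Union>m\<in>{-1, 0, 1}. Q m)" using m by blast
  qed
  then have "card ?S \<le> card (\<Union>m\<in>{-1, 0, 1}. Q m)" using fin by (intro card_mono) auto
  also have "\<dots> \<le> (\<Sum>m\<in>{-1, 0, 1}. card (Q m))" by (intro card_UN_le) auto
  finally have "real (card ?S) \<le> (\<Sum>m\<in>{-1, 0, 1}. real (card (Q m)))" unfolding of_nat_sum[symmetric] of_nat_le_iff .
  also have "\<dots> \<le> (\<Sum>m\<in>{-1, 0, 1::int}. 2 * (r * b ^ n + 1))" by (intro sum_mono cardQ)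
  finally show ?thesis by simp
qed

lemma card_image_le_of_factor:
  assumes "finite (g ` A)" "\<And>x y. x \<in> A \<Longrightarrow> y \<in> A \<Longrightarrow> g x = g y \<Longrightarrow> h x = h y"
  shows "finite (h ` A)" "card (h ` A) \<le> card (g ` A)"
proof -
  define k where "k z = h (SOME x. x \<in> A \<and> g x = z)" for z
  have "k (g x) = h x" if "x \<in> A" for x
  proof -
    have "(SOME y. y \<in> A \<and> g y = g x) \<in> A \<and> g (SOME y. y \<in> A \<and> g y = g x) = g x"
      using that by (intro someI[of "\<lambda>y. y \<in> A \<and> g y = g x" x]) auto
    then show ?thesis using assms(2) that unfolding k_def by blast
  qed
  then have "h ` A = k ` g ` A" by (force simp: image_image)
  then show "finite (h ` A)" "card (h ` A) \<le> card (g ` A)" using assms(1) card_image_le by auto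
qed

text \<open>\<open>A\<close> may fail to be measurable. The event \<open>E\<close> is the finite
  union of the cylinder events that fix the coordinates in \<open>J\<close> to a value occurring in
  \<open>A\<close>; these are equally likely.\<close>

lemma emeasure_PiM_uniform_le:
  fixes S :: "'p \<Rightarrow> 'a set"
  assumes S: "\<And>p. finite (S p)" "\<And>p. S p \<noteq> {}" and J: "finite J" and A: "A \<subseteq> PiE UNIV S"
    and fin: "finite ((\<lambda>\<omega>. restrict \<omega> J) ` A)"
  defines "P \<equiv> PiM UNIV (\<lambda>p. uniform_count_measure (S p))"
  shows "\<exists>E\<in>sets P. A \<subseteq> E \<and> emeasure P E \<le> ennreal (real (card ((\<lambda>\<omega>. restrict \<omega> J) ` A)) / (\<Prod>p\<in>J. real (card (S p))))"
proof -
  interpret product_prob_space "\<lambda>p. uniform_count_measure (S p)" UNIV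
    by (rule product_prob_spaceI) (use S in \<open>auto intro: prob_space_uniform_count_measure\<close>)
  define R where "R = (\<lambda>\<omega>. restrict \<omega> J) ` A"
  define cyl where "cyl w = {\<omega> \<in> space P. \<forall>p\<in>J. \<omega> p \<in> {w p}}" for w
  have spaceP: "space P = PiE UNIV S" unfolding P_def by (simp add: space_PiM space_uniform_count_measure)
  have w: "w p \<in> S p" if "w \<in> R" "p \<in> J" for w p using that A unfolding R_def by (auto simp: PiE_iff subset_iff)
  have em: "emeasure P (cyl w) = ennreal (1 / (\<Prod>p\<in>J. real (card (S p))))" if "w \<in> R" for w
  proof -
    have "emeasure P (cyl w) = (\<Prod>p\<in>J. emeasure (uniform_count_measure (S p)) {w p})"
      unfolding P_def cyl_def using J w[OF that]
      by (intro emeasure_PiM_Collect) (auto simp: sets_uniform_count_measure)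
    also have "\<dots> = (\<Prod>p\<in>J. ennreal (1 / real (card (S p))))"
      using S w[OF that] by (intro prod.cong) (auto simp: emeasure_uniform_count_measure)
    also have "\<dots> = ennreal (\<Prod>p\<in>J. 1 / real (card (S p)))" by (intro prod_ennreal) auto
    finally show ?thesis by (simp add: prod_dividef)
  qed
  have meas: "cyl w \<in> sets P" if "w \<in> R" for w
  proof -
    have "cyl w = prod_emb UNIV (\<lambda>p. uniform_count_measure (S p)) J (PiE J (\<lambda>p. {w p}))"
      unfolding cyl_def spaceP prod_emb_def by (auto simp: space_uniform_count_measure PiE_iff)
    also have "\<dots> \<in> sets P" unfolding P_def using J w[OF that]
      by (intro sets_PiM_I) (auto simp: sets_uniform_count_measure)
    finally show ?thesis .
  qed
  have "A \<subseteq> (\<Union>w\<in>R. cyl w)"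
  proof
    fix \<omega> assume "\<omega> \<in> A"
    then show "\<omega> \<in> (\<Union>w\<in>R. cyl w)" using A
      by (intro UN_I[of "restrict \<omega> J"]) (auto simp: R_def cyl_def spaceP)
  qed
  moreover have "(\<Union>w\<in>R. cyl w) \<in> sets P" using fin meas by (intro sets.finite_UN) (auto simp: R_def)
  moreover have "emeasure P (\<Union>w\<in>R. cyl w) \<le> ennreal (real (card R) / (\<Prod>p\<in>J. real (card (S p))))"
  proof -
    have "emeasure P (\<Union>w\<in>R. cyl w) \<le> (\<Sum>w\<in>R. emeasure P (cyl w))"
      using fin meas by (intro emeasure_subadditive_finite) (auto simp: R_def)
    also have "\<dots> = (\<Sum>w\<in>R. ennreal (1 / (\<Prod>p\<in>J. real (card (S p)))))" by (intro sum.cong refl em)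
    also have "\<dots> = ennreal (\<Sum>w\<in>R. 1 / (\<Prod>p\<in>J. real (card (S p))))"
      by (intro sum_ennreal) (simp add: prod_nonneg)
    finally show ?thesis by simp
  qed
  ultimately show ?thesis unfolding R_def by blast
qed

context target_tower
begin

lemma card_stage_choices_ge:
  assumes \<gamma>: "\<And>n. \<gamma> * b ^ n \<le> real (card (full_branches b n))"
  shows "\<gamma> * b ^ \<nu> j / b ^ start j \<le> real (card (stage_choices j))"
proof -
  have "b ^ \<nu> j = b ^ (\<nu> j - start j) * b ^ start j"
    using stage_start_le[of j] by (simp add: power_add[symmetric])
  then have "\<gamma> * b ^ \<nu> j / b ^ start j = \<gamma> * b ^ (\<nu> j - start j)" using b by simp
  then show ?thesis using \<gamma> unfolding stage_choices_def by simp
qed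

text \<open>The earlier factors are replaced by 1. With very sparse times little is lost, as the
  early stages occupy a negligible share of the time.\<close>

lemma prod_card_stage_choices_ge:
  "real (card (stage_choices j)) \<le> (\<Prod>k\<le>j. real (card (stage_choices k)))"
  "real (card (stage_choices j)) * real (card (stage_choices (Suc j))) \<le> (\<Prod>k\<le>Suc j. real (card (stage_choices k)))"
proof -
  have one: "1 \<le> real (card (stage_choices k))" for k
    using card_full_branches_pos[OF b] unfolding stage_choices_def by (simp add: Suc_le_eq)
  show *: "real (card (stage_choices j)) \<le> (\<Prod>k\<le>j. real (card (stage_choices k)))"
  proof (cases j)
    case (Suc i)
    have "1 \<le> (\<Prod>k\<le>i. real (card (stage_choices k)))" using one by (intro prod_ge_1) auto
    then show ?thesis unfolding Suc prod.atMost_Suc by (simp add: mult_le_cancel_right1)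
  qed simp
  show "real (card (stage_choices j)) * real (card (stage_choices (Suc j))) \<le> (\<Prod>k\<le>Suc j. real (card (stage_choices k)))"
    unfolding prod.atMost_Suc using * by (intro mult_right_mono) auto
qed

text \<open>
  A ball of radius \<open>r = exp (- \<rho> * \<nu> j)\<close> is measured at one of the two times \<open>\<nu> j\<close> and
  \<open>\<nu> (Suc j)\<close>, according to which term attains the maximum in the covering exponent.
\<close>
lemma tower_mass_le:
  assumes \<gamma>: "0 < \<gamma>" "\<And>n. \<gamma> * b ^ n \<le> real (card (full_branches b n))"
    and r: "r = exp (- \<rho> * real (\<nu> j))" "1 \<le> r * b ^ \<nu> (Suc j)"
    and early: "b ^ start j \<le> exp (\<eta> * real (\<nu> j))"
    and late: "b ^ (l j + 1) \<le> exp ((\<Lambda> + 2 * \<eta>) * real (\<nu> j))"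
    and \<eta>: "0 \<le> \<eta>"
  shows "\<exists>m. 6 * (r * b ^ \<nu> m + 1) / (\<Prod>k\<le>m. real (card (stage_choices k))) \<le>
    (12 / \<gamma> + 12 / \<gamma> ^ 2) * exp ((3 * \<eta> - cover_exponent \<Lambda> b \<rho>) * real (\<nu> j))"
proof -
  define n where "n = real (\<nu> j)"
  have n: "0 \<le> n" by (simp add: n_def)
  have pos: "0 < b ^ k" "0 \<le> b ^ k" for k using b by simp_all
  have r0: "0 < r" by (simp add: r)
  have bn: "b ^ \<nu> j = exp (ln b * n)" using b by (simp add: n_def exp_of_nat2_mult)
  have Spos: "0 < real (card (stage_choices k))" for k
    using card_full_branches_pos[OF b] unfolding stage_choices_def by simp
  have S1: "\<gamma> * b ^ \<nu> j / exp (\<eta> * n) \<le> real (card (stage_choices j))"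
  proof (rule order_trans[OF _ card_stage_choices_ge[OF \<gamma>(2)]])
    show "\<gamma> * b ^ \<nu> j / exp (\<eta> * n) \<le> \<gamma> * b ^ \<nu> j / b ^ start j"
      using early \<gamma> pos by (intro divide_left_mono) (auto simp: n_def)
  qed
  show ?thesis
  proof (cases "\<rho> - \<Lambda> \<le> min \<rho> (ln b)")
    case True
    \<comment> \<open>Here \<open>m = j\<close>. Up to constants and the early loss, the quotient is
      \<open>r + 1 / b ^ \<nu> j\<close>, of the order of its larger term.\<close>
    then have ce: "cover_exponent \<Lambda> b \<rho> = min \<rho> (ln b)" by (simp add: cover_exponent_def)
    have "6 * (r * b ^ \<nu> j + 1) / (\<Prod>k\<le>j. real (card (stage_choices k))) \<le>
      6 * (r * b ^ \<nu> j + 1) / (\<gamma> * b ^ \<nu> j / exp (\<eta> * n))"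
      using order_trans[OF S1 prod_card_stage_choices_ge(1)] \<gamma> pos r0 Spos
      by (intro divide_left_mono mult_pos_pos prod_pos) (auto intro: add_nonneg_nonneg less_imp_le)
    also have "\<dots> = 6 / \<gamma> * exp (\<eta> * n) * (r + 1 / b ^ \<nu> j)"
      using b \<gamma> by (simp add: field_simps)
    also have "\<dots> \<le> 6 / \<gamma> * exp (\<eta> * n) * (2 * exp (- min \<rho> (ln b) * n))"
    proof (intro mult_left_mono)
      have "r \<le> exp (- min \<rho> (ln b) * n)" unfolding r n_def[symmetric] using n by (auto intro!: mult_right_mono)
      moreover have "1 / b ^ \<nu> j \<le> exp (- min \<rho> (ln b) * n)"
        unfolding bn using n by (auto simp: exp_minus[symmetric] divide_inverse intro!: mult_right_mono)
      ultimately show "r + 1 / b ^ \<nu> j \<le> 2 * exp (- min \<rho> (ln b) * n)" by linarith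
    qed (use \<gamma> in auto)
    also have "\<dots> = 12 / \<gamma> * exp ((\<eta> - cover_exponent \<Lambda> b \<rho>) * n)"
      unfolding ce by (simp add: exp_add[symmetric] algebra_simps)
    also have "\<dots> \<le> (12 / \<gamma> + 12 / \<gamma> ^ 2) * exp ((3 * \<eta> - cover_exponent \<Lambda> b \<rho>) * n)"
      using \<gamma> \<eta> n by (intro mult_mono) (auto intro!: mult_right_mono)
    finally show ?thesis unfolding n_def by blast
  next
    case False
    then have ce: "cover_exponent \<Lambda> b \<rho> = \<rho> - \<Lambda>" unfolding cover_exponent_def by linarith
    \<comment> \<open>Here \<open>m = Suc j\<close>. The ball is longer than a cylinder of that
      order, so the summand 1 is absorbed and \<open>B\<close> cancels. What is left is
      \<open>r\<close> times the choices forgone: \<open>E\<close> before stage \<open>j\<close>,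
      and \<open>E'\<close> through its steering. The losses \<open>\<eta>\<close> and
      \<open>2 * \<eta>\<close> add up to \<open>3 * \<eta>\<close>.\<close>
    define B where "B = b ^ \<nu> (Suc j)"
    define E where "E = exp (\<eta> * n)"
    define E' where "E' = exp ((\<Lambda> + 2 * \<eta>) * n)"
    have B: "0 < B" using pos by (simp add: B_def)
    have E: "0 < E" "0 < E'" by (auto simp: E_def E'_def)
    have "\<gamma> * B / (b ^ \<nu> j * E') \<le> \<gamma> * B / b ^ start (Suc j)"
    proof (rule divide_left_mono)
      have "b ^ start (Suc j) = b ^ \<nu> j * b ^ (l j + 1)" by (simp add: power_add)
      also have "\<dots> \<le> b ^ \<nu> j * E'" using late pos(1)[of "\<nu> j"] unfolding E'_def n_def by (intro mult_left_mono) auto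
      finally show "b ^ start (Suc j) \<le> b ^ \<nu> j * E'" .
    qed (use \<gamma> B pos E b in \<open>auto intro!: mult_pos_pos\<close>)
    then have S2: "\<gamma> * B / (b ^ \<nu> j * E') \<le> real (card (stage_choices (Suc j)))"
      using card_stage_choices_ge[OF \<gamma>(2), of "Suc j"] unfolding B_def by linarith
    have "(\<gamma> * b ^ \<nu> j / E) * (\<gamma> * B / (b ^ \<nu> j * E')) \<le> real (card (stage_choices j)) * real (card (stage_choices (Suc j)))"
      using S1 S2 \<gamma> pos(1)[of "\<nu> j"] E B unfolding E_def by (intro mult_mono) auto
    also have "\<dots> \<le> (\<Prod>k\<le>Suc j. real (card (stage_choices k)))" by (rule prod_card_stage_choices_ge(2))
    also have "(\<gamma> * b ^ \<nu> j / E) * (\<gamma> * B / (b ^ \<nu> j * E')) = \<gamma> ^ 2 * B / (E * E')"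
      using b by (simp add: power2_eq_square)
    finally have mass: "\<gamma> ^ 2 * B / (E * E') \<le> (\<Prod>k\<le>Suc j. real (card (stage_choices k)))" .
    have "6 * (r * B + 1) / (\<Prod>k\<le>Suc j. real (card (stage_choices k))) \<le> 6 * (r * B + 1) / (\<gamma> ^ 2 * B / (E * E'))"
      using mass \<gamma> B E r0 Spos by (intro divide_left_mono mult_pos_pos prod_pos) auto
    also have "\<dots> \<le> 6 * (r * B + r * B) / (\<gamma> ^ 2 * B / (E * E'))"
      using r(2) \<gamma> B E unfolding B_def[symmetric] by (intro divide_right_mono) (auto simp: mult.commute)
    also have "\<dots> = 12 / \<gamma> ^ 2 * (r * (E * E'))" using B E \<gamma> by (simp add: field_simps)
    also have "r * (E * E') = exp ((3 * \<eta> - cover_exponent \<Lambda> b \<rho>) * n)"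
      unfolding ce r E_def E'_def n_def[symmetric] by (simp add: exp_add[symmetric] algebra_simps)
    also have "12 / \<gamma> ^ 2 * exp ((3 * \<eta> - cover_exponent \<Lambda> b \<rho>) * n) \<le>
      (12 / \<gamma> + 12 / \<gamma> ^ 2) * exp ((3 * \<eta> - cover_exponent \<Lambda> b \<rho>) * n)"
      using \<gamma> by (intro mult_right_mono) auto
    finally show ?thesis unfolding n_def B_def by blast
  qed
qed

end

section \<open>Lower bound\<close>

text \<open>If the measure vanished for some \<open>t < s\<close>, a cover with gauge sum below
  \<open>1 / (2 * C)\<close> would capture all the mass with total probability at most
  \<open>1 / 2 + 1 / 4\<close>. Outer events replace measurability of \<open>X\<close>.\<close>

lemma (in Metric_space) mass_distribution_principle:
  assumes P: "prob_space P" and X: "\<And>\<omega>. \<omega> \<in> space P \<Longrightarrow> X \<omega> \<in> A"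
    and C: "0 < C" and r0: "0 < r0" "r0 \<le> 1" and s: "0 < s"
    and mass: "\<And>U r. U \<subseteq> M \<Longrightarrow> U \<noteq> {} \<Longrightarrow> 0 < r \<Longrightarrow> r \<le> r0 \<Longrightarrow> (\<And>x y. x \<in> U \<Longrightarrow> y \<in> U \<Longrightarrow> d x y \<le> r) \<Longrightarrow>
      \<exists>E\<in>sets P. {\<omega> \<in> space P. X \<omega> \<in> U} \<subseteq> E \<and> emeasure P E \<le> ennreal (C * r powr s)"
  shows "ereal s \<le> hausdorff_dim A"
  unfolding hausdorff_dim_def
proof (rule INF_greatest)
  fix t assume "t \<in> {s. 0 \<le> s \<and> hausdorff_measure s A = 0}"
  then have t: "0 \<le> t" "hausdorff_measure t A = 0" by auto
  interpret prob_space P by (rule P)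
  show "ereal s \<le> ereal t"
  proof (rule ccontr)
    assume "\<not> ?thesis"
    then have ts: "t < s" by simp
    have "hausdorff_premeasure t r0 A \<le> 0"
      using r0 t(2) unfolding hausdorff_measure_def by (metis SUP_upper greaterThan_iff)
    then have "hausdorff_premeasure t r0 A < ennreal (1 / (2 * C))" using C by (simp add: ennreal_zero_less_divide)
    then obtain U where U: "U \<in> delta_covers r0 A" and small: "(\<Sum>n. hausdorff_gauge t (U n)) < ennreal (1 / (2 * C))"
      unfolding hausdorff_premeasure_def INF_less_iff by blast
    have UM: "U n \<subseteq> M" and diam: "\<And>x y. x \<in> U n \<Longrightarrow> y \<in> U n \<Longrightarrow> d x y \<le> r0" for n
      using U by (auto simp: delta_covers_def)
    have cov: "A \<subseteq> (\<Union>n. U n)" using U by (auto simp: delta_covers_def)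
    have "\<exists>E\<in>sets P. {\<omega> \<in> space P. X \<omega> \<in> U n} \<subseteq> E \<and>
       emeasure P E \<le> ennreal C * hausdorff_gauge t (U n) + ennreal ((1 / 2) ^ n / 8)" for n
    proof (cases "U n = {}")
      case True
      then show ?thesis by (intro bexI[of _ "{}"]) auto
    next
      case False
      then obtain x where x: "x \<in> U n" by auto
      have diam': "\<And>x y. x \<in> U n \<Longrightarrow> y \<in> U n \<Longrightarrow> d x y \<le> r0" using diam by blast
      have md: "0 \<le> mdiameter (U n)" "mdiameter (U n) \<le> r0"
        "\<And>x y. x \<in> U n \<Longrightarrow> y \<in> U n \<Longrightarrow> d x y \<le> mdiameter (U n)"
        using mdiameter_bounds[of "U n" x r0] UM[of n] x diam' by blast+
      show ?thesis
      proof (cases "mdiameter (U n) = 0")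
        case False
        define r where "r = mdiameter (U n)"
        have r: "0 < r" "r \<le> r0" using md(1,2) False by (auto simp: r_def)
        obtain E where E: "E \<in> sets P" "{\<omega> \<in> space P. X \<omega> \<in> U n} \<subseteq> E" "emeasure P E \<le> ennreal (C * r powr s)"
          using mass[OF UM \<open>U n \<noteq> {}\<close> r] md(3) unfolding r_def by blast
        have "ennreal (r powr s) \<le> hausdorff_gauge t (U n)"
        proof (cases "t = 0")
          case True
          have "r powr s \<le> 1" using r r0 s powr_mono2[of s r 1] by simp
          then show ?thesis using True \<open>U n \<noteq> {}\<close> by (simp add: hausdorff_gauge_def)
        next
          case False
          have "r powr s \<le> r powr t" using r r0 ts by (intro powr_mono') auto
          then show ?thesis using False \<open>U n \<noteq> {}\<close> by (simp add: hausdorff_gauge_def r_def ennreal_leI)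
        qed
        then have "ennreal (C * r powr s) \<le> ennreal C * hausdorff_gauge t (U n)"
          using C by (simp add: ennreal_mult mult_left_mono)
        then show ?thesis using E by (intro bexI[of _ E]) (auto intro: order_trans add_increasing2)
      next
        case True
        \<comment> \<open>A set of diameter 0 can have gauge 0, so its mass is bounded through an
          auxiliary radius with \<open>C * r powr s \<le> e\<close>. These errors sum to
          \<open>1 / 4\<close>.\<close>
        define e where "e = (1 / 2) ^ n / (8 :: real)"
        have e: "0 < e" by (simp add: e_def)
        define r where "r = min r0 ((e / C) powr (1 / s))"
        have r: "0 < r" "r \<le> r0" using r0 e C by (auto simp: r_def)
        have "d x y \<le> r" if "x \<in> U n" "y \<in> U n" for x y
          using md(3)[OF that] True r by linarith
        then obtain E where E: "E \<in> sets P" "{\<omega> \<in> space P. X \<omega> \<in> U n} \<subseteq> E" "emeasure P E \<le> ennreal (C * r powr s)"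
          using mass[OF UM \<open>U n \<noteq> {}\<close> r] by blast
        have "r powr s \<le> ((e / C) powr (1 / s)) powr s" using r s by (intro powr_mono2) (auto simp: r_def)
        also have "\<dots> = e / C" using s e C by (simp add: powr_powr)
        finally have "C * r powr s \<le> e" using C by (simp add: field_simps)
        then have "emeasure P E \<le> ennreal e" using E(3) by (meson ennreal_leI order_trans)
        then show ?thesis using E unfolding e_def by (intro bexI[of _ E]) (auto intro: add_increasing)
      qed
    qed
    then have "\<forall>n. \<exists>E. E \<in> sets P \<and> {\<omega> \<in> space P. X \<omega> \<in> U n} \<subseteq> E \<and>
       emeasure P E \<le> ennreal C * hausdorff_gauge t (U n) + ennreal ((1 / 2) ^ n / 8)"
      unfolding Bex_def by (rule allI)
    from choice[OF this] obtain E where "\<forall>n. E n \<in> sets P \<and> {\<omega> \<in> space P. X \<omega> \<in> U n} \<subseteq> E n \<and>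
       emeasure P (E n) \<le> ennreal C * hausdorff_gauge t (U n) + ennreal ((1 / 2) ^ n / 8)" ..
    then have E: "\<And>n. E n \<in> sets P" "\<And>n. {\<omega> \<in> space P. X \<omega> \<in> U n} \<subseteq> E n"
      "\<And>n. emeasure P (E n) \<le> ennreal C * hausdorff_gauge t (U n) + ennreal ((1 / 2) ^ n / 8)" by auto
    have sub: "space P \<subseteq> (\<Union>n. E n)"
    proof
      fix \<omega> assume \<omega>: "\<omega> \<in> space P"
      then obtain n where "X \<omega> \<in> U n" using X cov by blast
      then show "\<omega> \<in> (\<Union>n. E n)" using E(2)[of n] \<omega> by blast
    qed
    have half: "(\<Sum>n. ennreal ((1 / 2) ^ n / 8)) = ennreal (1 / 4)"
    proof -
      have "(\<lambda>n. (1 / 2) ^ n / 8) sums (1 / (1 - 1 / 2) / (8 :: real))"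
        by (intro sums_divide geometric_sums) auto
      then show ?thesis by (intro suminf_ennreal_eq) auto
    qed
    have "1 = emeasure P (space P)" by (simp add: emeasure_space_1)
    also have "\<dots> \<le> emeasure P (\<Union>n. E n)" using sub E(1) by (intro emeasure_mono) auto
    also have "\<dots> \<le> (\<Sum>n. emeasure P (E n))" using E(1) by (intro emeasure_subadditive_countably) auto
    also have "\<dots> \<le> (\<Sum>n. ennreal C * hausdorff_gauge t (U n) + ennreal ((1 / 2) ^ n / 8))"
      using E(3) by (intro suminf_le) auto
    also have "\<dots> = ennreal C * (\<Sum>n. hausdorff_gauge t (U n)) + ennreal (1 / 4)"
      by (subst suminf_add[symmetric]) (auto simp: half)
    also have "\<dots> \<le> ennreal C * ennreal (1 / (2 * C)) + ennreal (1 / 4)"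
      using small by (intro add_mono mult_left_mono) auto
    also have "ennreal C * ennreal (1 / (2 * C)) = ennreal (C * (1 / (2 * C)))"
      using C by (intro ennreal_mult[symmetric]) auto
    also have "C * (1 / (2 * C)) = 1 / 2" using C by simp
    also have "ennreal (1 / 2) + ennreal (1 / 4) = ennreal (1 / 2 + 1 / 4)"
      by (rule ennreal_plus[symmetric]) auto
    finally have "ennreal 1 \<le> ennreal (1 / 2 + 1 / 4)" by (simp only: ennreal_1)
    then show False by (subst (asm) ennreal_le_iff) auto
  qed
qed

text \<open>\<open>G \<kappa>\<close> stands for the times at which the true radius is at least
  \<open>exp (- \<kappa> * n)\<close>; this reduces the problem to exponential radii along a
  prescribed infinite set of times. The arbitrary gap \<open>s0 - s\<close> pays for all
  losses.\<close>

lemma hausdorff_dim_targets_ge: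
  fixes b :: "'n::finite \<Rightarrow> real" and a :: "real ^ 'n" and G :: "real \<Rightarrow> nat set"
  assumes b: "\<And>i. 1 < b i" and l: "0 \<le> l" and a: "a \<in> torus"
    and G: "\<And>\<kappa>. l < \<kappa> \<Longrightarrow> infinite (G \<kappa>)"
    and W: "\<And>\<kappa> x. l < \<kappa> \<Longrightarrow> x \<in> torus \<Longrightarrow>
      infinite {n \<in> G \<kappa>. \<forall>i. nint_dist ((beta_map (b i) ^^ n) (x $ i) - a $ i) \<le> exp (- \<kappa> * real n)} \<Longrightarrow> x \<in> W"
    and s0: "\<And>\<rho>. 0 < \<rho> \<Longrightarrow> s0 * \<rho> \<le> (\<Sum>i\<in>UNIV. cover_exponent l (b i) \<rho>)"
    and s: "0 < s" "s < s0"
  shows "ereal s \<le> torus_hausdorff_dim W"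
proof -
  \<comment> \<open>The slowest expansion rate. Placing \<open>r\<close> between consecutive values
    \<open>exp (- \<delta> * \<nu> j)\<close> gives both \<open>\<rho> \<ge> \<delta>\<close> and
    \<open>1 \<le> r * b i ^ \<nu> (Suc j)\<close> in every coordinate.\<close>
  define \<delta> where "\<delta> = Min (range (\<lambda>i. ln (b i)))"
  have \<delta>: "0 < \<delta>" using b unfolding \<delta>_def by (subst Min_gr_iff) auto
  have \<delta>b: "\<delta> \<le> ln (b i)" for i unfolding \<delta>_def by (intro Min_le) auto
  define D where "D = real CARD('n)"
  have D: "0 < D" by (simp add: D_def)
  \<comment> \<open>Each of the \<open>D\<close> coordinates loses \<open>3 * \<eta>\<close>, in
    total \<open>\<delta> * (s0 - s)\<close>.\<close>
  define \<eta> where "\<eta> = \<delta> * (s0 - s) / (3 * D)"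
  have \<eta>: "0 < \<eta>" using \<delta> s D by (simp add: \<eta>_def)
  \<comment> \<open>Strictly above \<open>l\<close>, so that suitable times exist, and strictly
    below the steering rate \<open>l + 2 * \<eta>\<close>.\<close>
  define \<kappa> where "\<kappa> = l + \<eta>"
  have \<kappa>: "l < \<kappa>" "0 \<le> \<kappa>" "\<kappa> < l + 2 * \<eta>" using \<eta> l by (auto simp: \<kappa>_def)
  have a': "0 \<le> a $ i" "a $ i < 1" for i using a by (auto simp: torus_def)
  have "\<forall>i. \<exists>N. \<forall>n\<ge>N. \<exists>l' c. c \<in> full_branches (b i) l' \<and> b i ^ (l' + 1) \<le> exp ((l + 2 * \<eta>) * real n) \<and>
           (\<forall>y. c \<le> y \<and> y < c + 1 / b i ^ l' \<longrightarrow> nint_dist (y - a $ i) \<le> exp (- \<kappa> * real n))"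
    using full_branch_in_target[OF b \<kappa>(2,3) a'] by blast
  then obtain N where N: "\<And>i n. N i \<le> n \<Longrightarrow> \<exists>l' c. c \<in> full_branches (b i) l' \<and> b i ^ (l' + 1) \<le> exp ((l + 2 * \<eta>) * real n) \<and>
           (\<forall>y. c \<le> y \<and> y < c + 1 / b i ^ l' \<longrightarrow> nint_dist (y - a $ i) \<le> exp (- \<kappa> * real n))"
    by metis
  \<comment> \<open>The successor also makes every chosen time positive, so that it can be divided
    by later.\<close>
  define N0 where "N0 = Suc (Max (range N))"
  have N0: "N i \<le> n" if "N0 \<le> n" for i n
  proof -
    have "N i \<le> Max (range N)" by (intro Max_ge) auto
    then show ?thesis using that unfolding N0_def by linarith
  qed
  have "\<forall>i n. \<exists>l' c. N0 \<le> n \<longrightarrow> (c \<in> full_branches (b i) l' \<and> b i ^ (l' + 1) \<le> exp ((l + 2 * \<eta>) * real n) \<and>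
           (\<forall>y. c \<le> y \<and> y < c + 1 / b i ^ l' \<longrightarrow> nint_dist (y - a $ i) \<le> exp (- \<kappa> * real n)))"
    using N N0 by blast
  then obtain L c where Lc: "\<And>i n. N0 \<le> n \<Longrightarrow> c i n \<in> full_branches (b i) (L i n)"
    "\<And>i n. N0 \<le> n \<Longrightarrow> b i ^ (L i n + 1) \<le> exp ((l + 2 * \<eta>) * real n)"
    "\<And>i n y. N0 \<le> n \<Longrightarrow> c i n \<le> y \<Longrightarrow> y < c i n + 1 / b i ^ L i n \<Longrightarrow> nint_dist (y - a $ i) \<le> exp (- \<kappa> * real n)"
    by (metis (no_types, lifting))
  have Gex: "\<exists>n'\<in>G \<kappa>. K \<le> real n'" for K
  proof -
    obtain n' where "nat \<lceil>K\<rceil> \<le> n'" "n' \<in> G \<kappa>"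
      using G[OF \<kappa>(1)] unfolding infinite_nat_iff_unbounded_le by blast
    then show ?thesis by (intro bexI[of _ n']) linarith+
  qed
  have "\<exists>\<nu>. \<forall>j. (\<nu> j \<in> G \<kappa> \<and> N0 \<le> \<nu> j) \<and> (\<nu> j < \<nu> (Suc j) \<and>
      (\<forall>i. \<nu> j + L i (\<nu> j) + 1 \<le> \<nu> (Suc j) \<and> real (\<nu> j + L i (\<nu> j) + 1) * ln (b i) \<le> \<eta> * real (\<nu> (Suc j))))"
  proof (rule dependent_nat_choice[where P = "\<lambda>_ n. n \<in> G \<kappa> \<and> N0 \<le> n" and Q = "\<lambda>_ n n'. n < n' \<and>
      (\<forall>i. n + L i n + 1 \<le> n' \<and> real (n + L i n + 1) * ln (b i) \<le> \<eta> * real n')"])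
    show "\<exists>n. n \<in> G \<kappa> \<and> N0 \<le> n" using Gex[of "real N0"] by auto
    fix n
    \<comment> \<open>The summand 1 makes room for the previous stage; the other one makes
      everything before the new time cost at most \<open>\<eta>\<close> per unit of time.\<close>
    define K where "K i = real (n + L i n + 1) * (1 + ln (b i) / \<eta>)" for i
    obtain n' where n': "n' \<in> G \<kappa>" "max (real N0) (Max (range K)) \<le> real n'" using Gex by blast
    have "n + L i n + 1 \<le> n'" "real (n + L i n + 1) * ln (b i) \<le> \<eta> * real n'" for i
    proof -
      have "K i \<le> Max (range K)" by (intro Max_ge) auto
      then have Kn: "K i \<le> real n'" using n' by simp
      have lnb: "0 \<le> ln (b i) / \<eta>" using b[of i] \<eta> by simp
      have "real (n + L i n + 1) * 1 \<le> K i" unfolding K_def using lnb by (intro mult_left_mono) auto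
      then have "real (n + L i n + 1) \<le> real n'" using Kn by (simp del: of_nat_add)
      then show "n + L i n + 1 \<le> n'" by (simp only: of_nat_le_iff)
      have "real (n + L i n + 1) * (ln (b i) / \<eta>) \<le> K i" unfolding K_def by (intro mult_left_mono) auto
      then have "real (n + L i n + 1) * (ln (b i) / \<eta>) \<le> real n'" using Kn by linarith
      then show "real (n + L i n + 1) * ln (b i) \<le> \<eta> * real n'" using \<eta> by (simp add: field_simps)
    qed
    moreover from this(1) have "n < n'" by (metis add_lessD1 less_eq_Suc_le Suc_eq_plus1)
    ultimately show "\<exists>n'. (n' \<in> G \<kappa> \<and> N0 \<le> n') \<and> n < n' \<and>
      (\<forall>i. n + L i n + 1 \<le> n' \<and> real (n + L i n + 1) * ln (b i) \<le> \<eta> * real n')"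
      using n' by (intro exI[of _ n']) auto
  qed
  then obtain \<nu> where \<nu>G: "\<And>j. \<nu> j \<in> G \<kappa>" and \<nu>N: "\<And>j. N0 \<le> \<nu> j" and \<nu>less: "\<And>j. \<nu> j < \<nu> (Suc j)"
    and \<nu>1: "\<And>j i. \<nu> j + L i (\<nu> j) + 1 \<le> \<nu> (Suc j)"
    and \<nu>2: "\<And>j i. real (\<nu> j + L i (\<nu> j) + 1) * ln (b i) \<le> \<eta> * real (\<nu> (Suc j))"
    by blast
  have \<nu>mono: "strict_mono \<nu>" using \<nu>less by (simp add: strict_mono_Suc_iff)
  have \<nu>pos: "0 < \<nu> j" for j using \<nu>N[of j] by (simp add: N0_def)
  define len where "len i j = L i (\<nu> j)" for i j
  define ctr where "ctr i j = c i (\<nu> j)" for i j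
  have tt: "target_tower (b i) \<nu> (len i) (ctr i)" for i
  proof
    show "1 < b i" by (rule b)
    show "ctr i j \<in> full_branches (b i) (len i j)" for j unfolding ctr_def len_def using Lc(1) \<nu>N by blast
    show "stage_start \<nu> (len i) j \<le> \<nu> j" for j using \<nu>1 by (cases j) (auto simp: len_def)
  qed
  interpret tt: target_tower "b i" \<nu> "len i" "ctr i" for i by (rule tt)
  have early: "b i ^ stage_start \<nu> (len i) j \<le> exp (\<eta> * real (\<nu> j))" for i j
  proof (cases j)
    case 0 then show ?thesis using \<eta> by simp
  next
    case (Suc k)
    have "b i ^ stage_start \<nu> (len i) j = exp (real (\<nu> k + L i (\<nu> k) + 1) * ln (b i))"
      unfolding Suc stage_start.simps len_def using b[of i] by (subst exp_of_nat_mult) simp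
    then show ?thesis using \<nu>2 Suc by simp
  qed
  have late: "b i ^ (len i j + 1) \<le> exp ((l + 2 * \<eta>) * real (\<nu> j))" for i j
    unfolding len_def using Lc(2) \<nu>N by blast
  have "\<forall>i. \<exists>\<gamma>>0. \<forall>n. \<gamma> * b i ^ n \<le> real (card (full_branches (b i) n))"
    using card_full_branches_ge[OF b] by metis
  then obtain \<gamma> where \<gamma>: "\<And>i. 0 < \<gamma> i" "\<And>i n. \<gamma> i * b i ^ n \<le> real (card (full_branches (b i) n))" by metis

  \<comment> \<open>The random point\<close>
  define S where "S p = tt.stage_choices (fst p) (snd p)" for p
  have S: "finite (S p)" "S p \<noteq> {}" for p
    unfolding S_def tt.stage_choices_def using finite_full_branches[OF b] full_branches_zero[OF b] by blast+
  define P where "P = PiM UNIV (\<lambda>p. uniform_count_measure (S p))"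
  have spaceP: "space P = PiE UNIV S" unfolding P_def by (simp add: space_PiM space_uniform_count_measure)
  have probP: "prob_space P" unfolding P_def using S by (intro prob_space_PiM prob_space_uniform_count_measure)
  define X where "X \<omega> = (\<chi> i. tt.tower_point i (\<lambda>j. \<omega> (i, j)))" for \<omega>
  have choice: "\<omega> (i, j) \<in> tt.stage_choices i j" if "\<omega> \<in> space P" for \<omega> i j
    using that unfolding spaceP S_def by (fastforce simp: PiE_iff)
  have Xtorus: "X \<omega> \<in> torus" if "\<omega> \<in> space P" for \<omega>
    unfolding torus_def X_def using tt.tower_point_in_unit[OF choice[OF that]] by simp
  have hit: "nint_dist (y - a $ i) \<le> exp (- \<kappa> * real (\<nu> j))"
    if "ctr i j \<le> y" "y < ctr i j + 1 / b i ^ len i j" for i j y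
    using that Lc(3)[OF \<nu>N] unfolding ctr_def len_def by blast
  have XW: "X \<omega> \<in> W" if \<omega>: "\<omega> \<in> space P" for \<omega>
  proof (rule W[OF \<kappa>(1) Xtorus[OF \<omega>]])
    have "range \<nu> \<subseteq> {n \<in> G \<kappa>. \<forall>i. nint_dist ((beta_map (b i) ^^ n) (X \<omega> $ i) - a $ i) \<le> exp (- \<kappa> * real n)}"
      using \<nu>G hit[OF tt.tower_point_hits[OF choice[OF \<omega>]]] by (auto simp: X_def)
    moreover have "infinite (range \<nu>)" using \<nu>mono strict_mono_imp_inj_on by (intro range_inj_infinite) blast
    ultimately show "infinite {n \<in> G \<kappa>. \<forall>i. nint_dist ((beta_map (b i) ^^ n) (X \<omega> $ i) - a $ i) \<le> exp (- \<kappa> * real n)}"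
      using finite_subset by blast
  qed
  define K where "K i = 12 / \<gamma> i + 12 / \<gamma> i ^ 2" for i
  have K: "0 < K i" for i using \<gamma>(1)[of i] by (auto simp: K_def intro!: add_pos_pos)
  define r0 where "r0 = exp (- \<delta> * real (\<nu> 0))"
  show ?thesis
  proof (rule torus.mass_distribution_principle[OF probP XW])
    show "0 < (\<Prod>i\<in>UNIV. K i)" using K by (intro prod_pos) auto
    show "0 < r0" "r0 \<le> 1" using \<delta> by (auto simp: r0_def)
    show "0 < s" by (rule s)

    \<comment> \<open>The mass of a small set\<close>
    fix U :: "(real ^ 'n) set" and r :: real
    assume U: "U \<subseteq> torus" "U \<noteq> {}" and r: "0 < r" "r \<le> r0"
      and diam: "\<And>x y. x \<in> U \<Longrightarrow> y \<in> U \<Longrightarrow> torus_dist x y \<le> r"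
    obtain u where u: "u \<in> U" using U by auto
    have ut: "0 \<le> u $ i" "u $ i < 1" for i using u U by (auto simp: torus_def)
    have "\<exists>j. exp (- \<delta> * real (\<nu> (Suc j))) < r \<and> r \<le> exp (- \<delta> * real (\<nu> j))"
    proof -
      have "(\<lambda>k. exp (- \<delta> * real k)) \<longlonglongrightarrow> 0" using \<delta> by real_asymp
      then obtain k where k: "exp (- \<delta> * real k) < r"
        using order_tendstoD(2)[OF _ r(1)] by (metis (mono_tags, lifting) eventually_sequentially order_refl)
      have "exp (- \<delta> * real (\<nu> k)) \<le> exp (- \<delta> * real k)"
        using strict_mono_imp_increasing[OF \<nu>mono, of k] \<delta> by simp
      then have ex: "exp (- \<delta> * real (\<nu> k)) < r" using k by linarith
      define m where "m = (LEAST m. exp (- \<delta> * real (\<nu> m)) < r)"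
      have m: "exp (- \<delta> * real (\<nu> m)) < r" unfolding m_def using ex by (rule LeastI)
      then have "m \<noteq> 0" using r(2) unfolding r0_def by (metis not_less)
      then obtain j where j: "m = Suc j" using not0_implies_Suc by blast
      then have "\<not> exp (- \<delta> * real (\<nu> j)) < r" unfolding m_def by (metis lessI not_less_Least)
      then show ?thesis using m j by auto
    qed
    then obtain j where j: "exp (- \<delta> * real (\<nu> (Suc j))) < r" "r \<le> exp (- \<delta> * real (\<nu> j))" by blast
    define n where "n = real (\<nu> j)"
    have n: "0 < n" using \<nu>pos by (simp add: n_def)
    define \<rho> where "\<rho> = - ln r / n"
    have r\<rho>: "r = exp (- \<rho> * n)" using n r by (simp add: \<rho>_def)
    have "- \<rho> * n \<le> - \<delta> * n" using j(2) unfolding r\<rho> n_def[symmetric] by simp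
    then have \<rho>: "0 < \<rho>" using n \<delta> by (simp add: mult_le_cancel_right_pos)
    have next1: "1 \<le> r * b i ^ \<nu> (Suc j)" for i
    proof -
      have "1 = exp (- \<delta> * real (\<nu> (Suc j))) * exp (\<delta> * real (\<nu> (Suc j)))" by (simp add: exp_add[symmetric])
      also have "\<dots> \<le> r * exp (ln (b i) * real (\<nu> (Suc j)))"
        using j(1) r \<delta>b by (intro mult_mono) (auto intro!: mult_right_mono)
      also have "exp (ln (b i) * real (\<nu> (Suc j))) = b i ^ \<nu> (Suc j)" using b[of i] by (simp add: exp_of_nat2_mult)
      finally show ?thesis .
    qed
    have "\<exists>m. 6 * (r * b i ^ \<nu> m + 1) / (\<Prod>k\<le>m. real (card (tt.stage_choices i k))) \<le>
        K i * exp ((3 * \<eta> - cover_exponent l (b i) \<rho>) * n)" for i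
      unfolding K_def n_def
      by (rule tt.tower_mass_le[OF \<gamma>(1) \<gamma>(2) r\<rho>[unfolded n_def] next1 early late less_imp_le[OF \<eta>]])
    then obtain m where m: "\<And>i. 6 * (r * b i ^ \<nu> (m i) + 1) / (\<Prod>k\<le>m i. real (card (tt.stage_choices i k))) \<le>
        K i * exp ((3 * \<eta> - cover_exponent l (b i) \<rho>) * n)" by metis
    \<comment> \<open>The coordinates may be measured at different stages \<open>m i\<close>;
      \<open>J\<close> collects exactly the choices that are fixed by the half towers of these
      stages.\<close>
    define J where "J = (SIGMA i:UNIV. {..m i})"
    have finJ: "finite J" by (simp add: J_def)
    define A where "A = {\<omega> \<in> space P. X \<omega> \<in> U}"
    define g where "g \<omega> = (\<lambda>i. tt.half_tower i (\<lambda>j. \<omega> (i, j)) (m i))" for \<omega>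
    define B where "B i = {y \<in> full_branches (b i) (\<nu> (m i)). \<exists>x. 0 \<le> x \<and> x < 1 \<and> y \<le> x \<and> x \<le> y + 1 / b i ^ \<nu> (m i) \<and> nint_dist (x - u $ i) \<le> r}" for i
    have finB: "finite (B i)" for i unfolding B_def using finite_full_branches[OF b] by auto
    have gA: "g ` A \<subseteq> PiE UNIV B"
    proof
      fix z assume "z \<in> g ` A"
      then obtain \<omega> where \<omega>: "\<omega> \<in> space P" "X \<omega> \<in> U" "z = g \<omega>" by (auto simp: A_def)
      note ch = choice[OF \<omega>(1)]
      have "z i \<in> B i" for i
      proof -
        have "nint_dist (X \<omega> $ i - u $ i) \<le> r" using diam[OF \<omega>(2) u] by (simp add: torus_dist_le_iff)
        then show ?thesis unfolding B_def \<omega>(3) g_def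
          using tt.tower_mem(2)[OF ch] tt.tower_point_in_unit[OF ch] tt.tower_point_bounds(3,4)[OF ch]
          by (auto simp: X_def intro!: exI[of _ "tt.tower_point i (\<lambda>j. \<omega> (i, j))"])
      qed
      then show "z \<in> PiE UNIV B" by (simp add: PiE_iff)
    qed
    have fing: "finite (g ` A)" using gA finB by (metis finite_PiE finite_class.finite_UNIV finite_subset)
    have inj: "restrict \<omega> J = restrict \<omega>' J" if "\<omega> \<in> A" "\<omega>' \<in> A" "g \<omega> = g \<omega>'" for \<omega> \<omega>'
    proof (rule restrict_ext)
      fix p assume "p \<in> J"
      then obtain i k where p: "p = (i, k)" "k \<le> m i" by (auto simp: J_def)
      have "tt.half_tower i (\<lambda>j. \<omega> (i, j)) (m i) = tt.half_tower i (\<lambda>j. \<omega>' (i, j)) (m i)"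
        using that(3) unfolding g_def by meson
      then show "\<omega> p = \<omega>' p" using tt.half_tower_inj[OF choice choice _ p(2)] that(1,2) p(1) by (auto simp: A_def)
    qed
    note restr = card_image_le_of_factor[OF fing inj]
    have "real (card ((\<lambda>\<omega>. restrict \<omega> J) ` A)) \<le> real (card (g ` A))" using restr(2) by simp
    also have "\<dots> \<le> real (card (PiE UNIV B))"
      using gA finB by (intro of_nat_mono card_mono finite_PiE) auto
    also have "\<dots> = (\<Prod>i\<in>UNIV. real (card (B i)))" by (simp add: card_PiE)
    also have "\<dots> \<le> (\<Prod>i\<in>UNIV. 6 * (r * b i ^ \<nu> (m i) + 1))"
      unfolding B_def using card_branches_near_le[OF b ut less_imp_le[OF r(1)]] by (intro prod_mono) auto
    finally have cardR: "real (card ((\<lambda>\<omega>. restrict \<omega> J) ` A)) \<le> (\<Prod>i\<in>UNIV. 6 * (r * b i ^ \<nu> (m i) + 1))" .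
    have prodJ: "(\<Prod>p\<in>J. real (card (S p))) = (\<Prod>i\<in>UNIV. \<Prod>k\<le>m i. real (card (tt.stage_choices i k)))"
      unfolding J_def by (subst prod.Sigma) (auto simp: S_def intro!: prod.cong)
    have "real (card ((\<lambda>\<omega>. restrict \<omega> J) ` A)) / (\<Prod>p\<in>J. real (card (S p))) \<le>
       (\<Prod>i\<in>UNIV. 6 * (r * b i ^ \<nu> (m i) + 1)) / (\<Prod>p\<in>J. real (card (S p)))"
      using cardR by (intro divide_right_mono prod_nonneg) auto
    also have "\<dots> = (\<Prod>i\<in>UNIV. 6 * (r * b i ^ \<nu> (m i) + 1) / (\<Prod>k\<le>m i. real (card (tt.stage_choices i k))))"
      unfolding prodJ by (rule prod_dividef[symmetric])
    also have "\<dots> \<le> (\<Prod>i\<in>UNIV. K i * exp ((3 * \<eta> - cover_exponent l (b i) \<rho>) * n))"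
    proof (intro prod_mono conjI m)
      show "0 \<le> 6 * (r * b i ^ \<nu> (m i) + 1) / (\<Prod>k\<le>m i. real (card (tt.stage_choices i k)))" for i
        using r b[of i] by (intro divide_nonneg_nonneg prod_nonneg) auto
    qed
    also have "\<dots> = (\<Prod>i\<in>UNIV. K i) * exp (\<Sum>i\<in>UNIV. (3 * \<eta> - cover_exponent l (b i) \<rho>) * n)"
      by (simp add: prod.distrib exp_sum)
    also have "\<dots> \<le> (\<Prod>i\<in>UNIV. K i) * r powr s"
    proof (rule mult_left_mono)
      have "(\<Sum>i\<in>UNIV. (3 * \<eta> - cover_exponent l (b i) \<rho>) * n) = (3 * \<eta> * D - (\<Sum>i\<in>UNIV. cover_exponent l (b i) \<rho>)) * n"
        by (simp add: sum_distrib_right[symmetric] sum_subtractf D_def)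
      also have "3 * \<eta> * D = \<delta> * (s0 - s)" using D by (simp add: \<eta>_def)
      \<comment> \<open>Since \<open>\<delta> \<le> \<rho>\<close>, the total loss is at most
        \<open>\<rho> * (s0 - s)\<close>, which turns the exponent \<open>s0\<close> into
        \<open>s\<close>.\<close>
      also have "(\<delta> * (s0 - s) - (\<Sum>i\<in>UNIV. cover_exponent l (b i) \<rho>)) * n \<le> (\<rho> * (s0 - s) - s0 * \<rho>) * n"
        using s0[OF \<rho>] \<open>- \<rho> * n \<le> - \<delta> * n\<close> n s
        by (intro mult_right_mono diff_mono mult_right_mono) auto
      also have "\<dots> = - s * (\<rho> * n)" by (simp add: algebra_simps)
      also have "\<rho> * n = - ln r" using n by (simp add: \<rho>_def)
      finally show "exp (\<Sum>i\<in>UNIV. (3 * \<eta> - cover_exponent l (b i) \<rho>) * n) \<le> r powr s"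
        using r by (simp add: powr_def)
      show "0 \<le> (\<Prod>i\<in>UNIV. K i)" using K by (intro prod_nonneg) (auto intro: less_imp_le)
    qed
    finally have small: "real (card ((\<lambda>\<omega>. restrict \<omega> J) ` A)) / (\<Prod>p\<in>J. real (card (S p))) \<le> (\<Prod>i\<in>UNIV. K i) * r powr s" .
    have "A \<subseteq> PiE UNIV S" unfolding A_def spaceP by auto
    from emeasure_PiM_uniform_le[OF S finJ this restr(1), folded P_def]
    obtain E where "E \<in> sets P" "A \<subseteq> E"
      "emeasure P E \<le> ennreal (real (card ((\<lambda>\<omega>. restrict \<omega> J) ` A)) / (\<Prod>p\<in>J. real (card (S p))))" by blast
    then show "\<exists>E\<in>sets P. {\<omega> \<in> space P. X \<omega> \<in> U} \<subseteq> E \<and> emeasure P E \<le> ennreal ((\<Prod>i\<in>UNIV. K i) * r powr s)"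
      unfolding A_def[symmetric] using small by (meson ennreal_leI order_trans)
  qed
qed

section \<open>Diagonal matrix transformations\<close>

lemma shrinking_target_set_diagonal:
  assumes "diagonal_matrix T"
  shows "x \<in> shrinking_target_set T \<psi> a \<longleftrightarrow> x \<in> torus \<and>
    infinite {n. 1 \<le> n \<and> (\<forall>i. nint_dist ((beta_map (T $ i $ i) ^^ n) (x $ i) - a $ i) \<le> \<psi> (real n))}"
proof -
  have "(torus_map T ^^ n) x \<in> torus_ball a r \<longleftrightarrow>
      (\<forall>i. nint_dist ((beta_map (T $ i $ i) ^^ n) (x $ i) - a $ i) \<le> r)" if "x \<in> torus" for n r
  proof -
    have "(torus_map T ^^ n) x \<in> torus"
      using that funpow_beta_map_bounds by (simp add: torus_def torus_map_funpow_diagonal[OF assms])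
    then show ?thesis
      using torus_dist_le_iff[of "(torus_map T ^^ n) x" a r]
      by (simp add: torus_ball_def torus_dist_def torus_map_funpow_diagonal[OF assms])
  qed
  then show ?thesis unfolding shrinking_target_set_def by (auto cong: conj_cong)
qed

text \<open>A liminf below \<open>\<kappa>\<close> yields information at infinitely many times only,
  which is why the lower bound is built along a sparse set of times.\<close>

lemma infinite_large_radii:
  assumes \<psi>: "\<And>x. 0 < x \<Longrightarrow> 0 < \<psi> x" and "lower_order \<psi> < ereal \<kappa>"
  shows "infinite {n :: nat. 1 \<le> n \<and> exp (- \<kappa> * real n) \<le> \<psi> (real n)}"
proof
  assume fin: "finite {n :: nat. 1 \<le> n \<and> exp (- \<kappa> * real n) \<le> \<psi> (real n)}"
  then obtain N where N: "\<And>n. n \<in> {n :: nat. 1 \<le> n \<and> exp (- \<kappa> * real n) \<le> \<psi> (real n)} \<Longrightarrow> n \<le> N"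
    using finite_nat_set_iff_bounded_le by auto
  have "ereal \<kappa> \<le> lower_order \<psi>"
    unfolding lower_order_def
  proof (rule Liminf_bounded)
    show "eventually (\<lambda>n. ereal \<kappa> \<le> ereal (- ln (\<psi> (real n)) / real n)) sequentially"
      unfolding eventually_sequentially
    proof (intro exI[of _ "Suc N"] allI impI)
      fix n assume n: "Suc N \<le> n"
      then have "\<psi> (real n) < exp (- \<kappa> * real n)" using N[of n] by force
      then have "ln (\<psi> (real n)) < ln (exp (- \<kappa> * real n))" using \<psi>[of "real n"] n by (subst ln_less_cancel_iff) auto
      then have "\<kappa> * real n \<le> - ln (\<psi> (real n))" by simp
      then have "\<kappa> \<le> - ln (\<psi> (real n)) / real n" using n by (subst pos_le_divide_eq) auto
      then show "ereal \<kappa> \<le> ereal (- ln (\<psi> (real n)) / real n)" by simp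
    qed
  qed
  then show False using assms(2) by simp
qed

lemma eventually_small_radii:
  assumes \<psi>: "\<And>x. 0 < x \<Longrightarrow> 0 < \<psi> x" and "ereal \<kappa> < lower_order \<psi>"
  shows "\<exists>N. \<forall>n\<ge>N. \<psi> (real n) \<le> exp (- \<kappa> * real n)"
proof -
  have "eventually (\<lambda>n. ereal \<kappa> < ereal (- ln (\<psi> (real n)) / real n)) sequentially"
    using assms(2) unfolding lower_order_def by (rule less_LiminfD)
  then obtain N where N: "\<And>n. N \<le> n \<Longrightarrow> \<kappa> < - ln (\<psi> (real n)) / real n" by (auto simp: eventually_sequentially)
  show ?thesis
  proof (intro exI[of _ "Suc N"] allI impI)
    fix n assume n: "Suc N \<le> n"
    then have "\<kappa> * real n < - ln (\<psi> (real n))"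
      using N[of n] by (subst pos_less_divide_eq[symmetric]) auto
    then have "ln (\<psi> (real n)) \<le> - \<kappa> * real n" by simp
    then have "exp (ln (\<psi> (real n))) \<le> exp (- \<kappa> * real n)" by (simp only: exp_le_cancel_iff)
    then show "\<psi> (real n) \<le> exp (- \<kappa> * real n)" using \<psi>[of "real n"] n by simp
  qed
qed

theorem theorem6:
  fixes T :: "real ^ 'n ^ 'n" and \<beta> :: "nat \<Rightarrow> real" and \<psi> :: "real \<Rightarrow> real" and a :: "real ^ 'n"
  assumes "invertible T"
    and "diagonal_matrix T"
    and "eigenvalues_of T \<beta>"
    and "\<And>i. i \<in> {1..CARD('n)} \<Longrightarrow> 1 < \<beta> i"
    and "mono_on {1..CARD('n)} \<beta>"
    and "\<And>x. 0 < x \<Longrightarrow> 0 < \<psi> x"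
    and "0 \<le> lower_order \<psi>"
    and "a \<in> torus"
  shows "torus_hausdorff_dim (shrinking_target_set T \<psi> a) =
           ereal (MIN i \<in> {1..CARD('n)}. theta CARD('n) \<beta> i (lower_order \<psi>))"
proof -
  define d where "d = CARD('n)"
  have d: "1 \<le> d" by (simp add: d_def Suc_le_eq)
  define b where "b i = T $ i $ i" for i
  define W where "W = shrinking_target_set T \<psi> a"
  note W_iff = shrinking_target_set_diagonal[OF assms(2), of _ \<psi> a, folded b_def W_def]
  have \<beta>: "1 < \<beta> k" if "k \<in> {1..d}" for k using assms(4) that by (simp add: d_def)
  note mset = eigenvalues_of_diagonal_matrix[OF assms(2,3), folded b_def d_def]
  have b: "1 < b i" for i
  proof -
    have "b i \<in># image_mset b (mset_set UNIV)" by simp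
    then show ?thesis unfolding mset using \<beta> by auto
  qed
  define F where "F l \<rho> = (\<Sum>k\<in>{1..d}. cover_exponent l (\<beta> k) \<rho>)" for l \<rho>
  have F_coords: "(\<Sum>i\<in>UNIV. cover_exponent l (b i) \<rho>) = F l \<rho>" for l \<rho>
  proof -
    have "(\<Sum>i\<in>UNIV. cover_exponent l (b i) \<rho>) = sum_mset (image_mset (\<lambda>x. cover_exponent l x \<rho>) (image_mset b (mset_set UNIV)))"
      by (simp add: sum_unfold_sum_mset multiset.map_comp comp_def)
    then show ?thesis unfolding mset by (simp add: F_def sum_unfold_sum_mset multiset.map_comp comp_def)
  qed
  have upper: "torus_hausdorff_dim W \<le> ereal (F l \<rho> / \<rho>)"
    if l: "0 \<le> l" "l = 0 \<or> ereal l < lower_order \<psi>" and \<rho>: "0 < \<rho>" for l \<rho>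
    unfolding F_coords[symmetric]
  proof (rule hausdorff_dim_targets_le[OF b l(1) \<rho> assms(8)])
    show "W \<subseteq> torus" by (simp add: subset_iff W_iff)
    fix x assume x: "x \<in> W"
    show "infinite {n. \<forall>i. nint_dist ((beta_map (b i) ^^ n) (x $ i) - a $ i) \<le> exp (- l * real n)}"
    proof (cases "l = 0")
      case True
      \<comment> \<open>For \<open>l = 0\<close> the target has radius 1 and is always hit. This
        case is needed when the lower order is 0 and no smaller \<open>l\<close> is
        available.\<close>
      have "nint_dist y \<le> 1" for y using of_int_round_abs_le[of y] by (simp add: nint_dist_def abs_minus_commute)
      then show ?thesis using True by simp
    next
      case False
      then obtain N where N: "\<And>n. N \<le> n \<Longrightarrow> \<psi> (real n) \<le> exp (- l * real n)"
        using eventually_small_radii[of \<psi> l] assms(6) l(2) by blast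
      define A where "A = {n. 1 \<le> n \<and> (\<forall>i. nint_dist ((beta_map (b i) ^^ n) (x $ i) - a $ i) \<le> \<psi> (real n))}"
      have "infinite A" using x W_iff by (simp add: A_def)
      then have "infinite (A - {..<N})" by simp
      moreover have "A - {..<N} \<subseteq> {n. \<forall>i. nint_dist ((beta_map (b i) ^^ n) (x $ i) - a $ i) \<le> exp (- l * real n)}"
      proof
        fix n assume n: "n \<in> A - {..<N}"
        then have "nint_dist ((beta_map (b i) ^^ n) (x $ i) - a $ i) \<le> \<psi> (real n)" for i by (simp add: A_def)
        moreover have "\<psi> (real n) \<le> exp (- l * real n)" using N n by simp
        ultimately show "n \<in> {n. \<forall>i. nint_dist ((beta_map (b i) ^^ n) (x $ i) - a $ i) \<le> exp (- l * real n)}"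
          using order_trans by blast
      qed
      ultimately show ?thesis using finite_subset by blast
    qed
  qed
  have dim0: "0 \<le> torus_hausdorff_dim W" by (rule torus.hausdorff_dim_nonneg)
  define \<theta> where "\<theta> i = theta d \<beta> i (lower_order \<psi>)" for i
  have fin: "finite (\<theta> ` {1..d})" "\<theta> ` {1..d} \<noteq> {}" using d by auto
  have "torus_hausdorff_dim W = ereal (Min (\<theta> ` {1..d}))"
  proof (cases "lower_order \<psi> = \<infinity>")
    case True
    have "\<theta> ` {1..d} = {0}" using d True by (auto simp: \<theta>_def theta_def image_constant_conv)
    moreover have "torus_hausdorff_dim W \<le> 0"
    proof (rule ereal_le_epsilon2)
      fix e :: real assume e: "0 < e"
      define S where "S = (\<Sum>k\<in>{1..d}. ln (\<beta> k))"
      have S: "0 \<le> S" unfolding S_def using \<beta> by (intro sum_nonneg) (simp add: less_imp_le)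
      \<comment> \<open>At scale \<open>\<rho> = l\<close> each exponent is at most
        \<open>ln (\<beta> k)\<close>, so the bound is \<open>S / l \<le> e\<close>. The summand 1
        keeps \<open>l\<close> positive.\<close>
      define l where "l = (S + 1) / e"
      have l: "0 < l" using S e by (simp add: l_def)
      have "cover_exponent l (\<beta> k) l \<le> ln (\<beta> k)" if "k \<in> {1..d}" for k
        using \<beta>[OF that] by (simp add: cover_exponent_def less_imp_le)
      then have "F l l \<le> S" unfolding F_def S_def by (rule sum_mono)
      then have "F l l / l \<le> S / l" using l by (simp add: divide_right_mono)
      also have "\<dots> \<le> e" using S e by (simp add: l_def field_simps)
      finally have "F l l / l \<le> e" .
      then show "torus_hausdorff_dim W \<le> 0 + ereal e"
        using order_trans[OF upper[of l l]] l True by simp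
    qed
    ultimately show ?thesis using dim0 by (simp add: order_antisym zero_ereal_def)
  next
    case False
    then obtain l where lo: "lower_order \<psi> = ereal l" and l: "0 \<le> l"
      using assms(7) by (cases "lower_order \<psi>") auto
    define kink where "kink i = ln (\<beta> i) + l" for i
    have kink: "0 < kink i" if "i \<in> {1..d}" for i using \<beta>[OF that] l by (simp add: kink_def add_pos_nonneg)
    have \<theta>: "\<theta> i = F l (kink i) / kink i" if "i \<in> {1..d}" for i
      unfolding \<theta>_def lo F_def kink_def using theta_eq_cover_exponent[OF \<beta> _ that l] assms(5) by (simp add: d_def)
    have le: "torus_hausdorff_dim W \<le> ereal (\<theta> i)" if i: "i \<in> {1..d}" for i
    proof (rule ereal_le_epsilon2)
      fix e :: real assume e: "0 < e"
      \<comment> \<open>Lowering \<open>l\<close> by at most \<open>\<epsilon>\<close> costs at most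
        \<open>\<epsilon>\<close> in each of \<open>d\<close> exponents, hence at most
        \<open>e\<close> after division by \<open>kink i\<close>.\<close>
      define \<epsilon> where "\<epsilon> = e * kink i / real d"
      have \<epsilon>: "0 < \<epsilon>" using e kink[OF i] d by (simp add: \<epsilon>_def)
      define l' where "l' = max 0 (l - \<epsilon>)"
      have l': "0 \<le> l'" "l' = 0 \<or> ereal l' < lower_order \<psi>" "l' \<le> l" "l - l' \<le> \<epsilon>"
        using \<epsilon> l by (auto simp: l'_def lo max_def)
      have "F l' (kink i) \<le> (\<Sum>k\<in>{1..d}. cover_exponent l (\<beta> k) (kink i) + \<epsilon>)"
        unfolding F_def using l'(4) by (intro sum_mono order_trans[OF cover_exponent_diff_le[OF l'(3)]]) simp
      also have "\<dots> = F l (kink i) + e * kink i" using d by (simp add: sum.distrib F_def \<epsilon>_def)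
      finally have "F l' (kink i) / kink i \<le> (F l (kink i) + e * kink i) / kink i"
        using kink[OF i] by (intro divide_right_mono) auto
      also have "\<dots> = \<theta> i + e" using kink[OF i] \<theta>[OF i] by (simp add: add_divide_distrib)
      finally have "F l' (kink i) / kink i \<le> \<theta> i + e" .
      then show "torus_hausdorff_dim W \<le> ereal (\<theta> i) + ereal e"
        using order_trans[OF upper[OF l'(1,2) kink[OF i]]] by simp
    qed
    define s0 where "s0 = Min (\<theta> ` {1..d})"
    have "s0 \<in> \<theta> ` {1..d}" unfolding s0_def using fin by (rule Min_in)
    then have "torus_hausdorff_dim W \<le> ereal s0" using le by auto
    moreover have "ereal s0 \<le> torus_hausdorff_dim W"
    proof (rule ereal_le_epsilon2)
      fix e :: real assume e: "0 < e"
      have s0F: "s0 * \<rho> \<le> F l \<rho>" if "0 < \<rho>" for \<rho>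
        unfolding F_def
      proof (rule cover_exponent_sum_ge[OF _ _ \<beta> l that])
        fix i assume i: "i \<in> {1..d}"
        have "s0 \<le> \<theta> i" unfolding s0_def using fin i by (intro Min_le) auto
        then show "s0 * (ln (\<beta> i) + l) \<le> (\<Sum>k\<in>{1..d}. cover_exponent l (\<beta> k) (ln (\<beta> i) + l))"
          unfolding \<theta>[OF i] using kink[OF i] unfolding F_def kink_def by (simp add: le_divide_eq)
      qed (use d in auto)
      show "ereal s0 \<le> torus_hausdorff_dim W + ereal e"
      proof (cases "0 < s0 - e")
        case True
        define G where "G \<kappa> = {n :: nat. 1 \<le> n \<and> exp (- \<kappa> * real n) \<le> \<psi> (real n)}" for \<kappa>
        have "ereal (s0 - e) \<le> torus_hausdorff_dim W"
        proof (rule hausdorff_dim_targets_ge[OF b l assms(8), of G])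
          show "infinite (G \<kappa>)" if "l < \<kappa>" for \<kappa>
            unfolding G_def using infinite_large_radii[of \<psi> \<kappa>] assms(6) that lo by simp
          show "s0 * \<rho> \<le> (\<Sum>i\<in>UNIV. cover_exponent l (b i) \<rho>)" if "0 < \<rho>" for \<rho>
            unfolding F_coords by (rule s0F[OF that])
          show "0 < s0 - e" "s0 - e < s0" using True e by auto
          fix \<kappa> x assume x: "x \<in> torus" and
            inf: "infinite {n \<in> G \<kappa>. \<forall>i. nint_dist ((beta_map (b i) ^^ n) (x $ i) - a $ i) \<le> exp (- \<kappa> * real n)}"
          have "{n \<in> G \<kappa>. \<forall>i. nint_dist ((beta_map (b i) ^^ n) (x $ i) - a $ i) \<le> exp (- \<kappa> * real n)} \<subseteq>
            {n. 1 \<le> n \<and> (\<forall>i. nint_dist ((beta_map (b i) ^^ n) (x $ i) - a $ i) \<le> \<psi> (real n))}"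
            unfolding G_def using order_trans by blast
          then show "x \<in> W" unfolding W_iff using x inf finite_subset by blast
        qed
        then have "ereal (s0 - e) + ereal e \<le> torus_hausdorff_dim W + ereal e" by (rule add_right_mono)
        then show ?thesis by simp
      next
        case False
        then have "ereal s0 \<le> 0 + ereal e" by simp
        also have "\<dots> \<le> torus_hausdorff_dim W + ereal e" using dim0 by (rule add_right_mono)
        finally show ?thesis .
      qed
    qed
    ultimately show ?thesis unfolding s0_def by (rule order_antisym)
  qed
  then show ?thesis unfolding W_def d_def \<theta>_def .
qed

end
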